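(* Let $\Gamma=\{(x_1,x_2)\in\mathbb{R}^2: x_1x_2=1\}$ and let $\alpha,\beta>0$ be real numbers with $\alpha\beta>1$. Then the complex vector space $\mathrm{AC}(\Gamma;\Lambda_{\alpha,\beta})$ is infinite-dimensional.
   Context: For $\alpha,\beta>0$ the lattice-cross is $\Lambda_{\alpha,\beta}=(\alpha\mathbb{Z}\times\{0\})\cup(\{0\}\times\beta\mathbb{Z})\subset\mathbb{R}^2$. For a finite disjoint union $\Gamma$ of smooth curves in the plane and a set $\Lambda\subset\mathbb{R}^2$, $\mathrm{AC}(\Gamma;\Lambda)$ denotes the space of finite complex Borel measures $\mu$ on $\mathbb{R}^2$ that are supported on $\Gamma$, absolutely continuous with respect to arc length on $\Gamma$, and whose Fourier transform $$\widehat{\mu}(x_1,x_2)=\int_{\Gamma} e^{i\pi(x_1y_1+x_2y_2)}\,d\mu(y_1,y_2),\qquad (x_1,x_2)\in\mathbb{R}^2,$$ vanishes at every point of $\Lambda$. *)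

theory Defs
  imports "HOL-Analysis.Analysis" "HOL-Library.Function_Algebras"
begin

text \<open>
  A complex Borel measure is a countably additive complex-valued function on the Borel sets.
  Its value outside the Borel sets is fixed to be 0, so that two of them are equal as functions
  iff they agree on all Borel sets.
\<close>

definition complex_borel_measure :: "('a::topological_space set \<Rightarrow> complex) \<Rightarrow> bool" where
  "complex_borel_measure \<mu> \<longleftrightarrow>
     (\<forall>A. A \<notin> sets borel \<longrightarrow> \<mu> A = 0) \<and> \<mu> {} = 0 \<and>
     (\<forall>A::nat \<Rightarrow> 'a set. range A \<subseteq> sets borel \<longrightarrow> disjoint_family A \<longrightarrow>
        (\<lambda>n. \<mu> (A n)) sums \<mu> (\<Union>n. A n))"

text \<open>
  For a finite signed Borel measure \<open>\<nu>\<close>, the positive part of its Jordan decomposition,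
  \<open>\<nu>\<^sup>+(A) = sup {\<nu>(B) | B \<subseteq> A Borel}\<close>. Since \<open>\<nu>({}) = 0\<close> the supremum is nonnegative, so the
  truncation of negative values by \<^const>\<open>ennreal\<close> has no effect. The negative part is
  the positive part of \<open>-\<nu>\<close>.
\<close>

definition jordan_pos :: "('a::topological_space set \<Rightarrow> real) \<Rightarrow> 'a measure" where
  "jordan_pos \<nu> =
     measure_of UNIV (sets borel) (\<lambda>A. SUP B\<in>{B \<in> sets borel. B \<subseteq> A}. ennreal (\<nu> B))"

definition signed_integral ::
  "('a::topological_space set \<Rightarrow> real) \<Rightarrow> ('a \<Rightarrow> complex) \<Rightarrow> complex" where
  "signed_integral \<nu> f =
     (\<integral>x. f x \<partial>jordan_pos \<nu>) - (\<integral>x. f x \<partial>jordan_pos (\<lambda>A. - \<nu> A))"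

definition cmeasure_integral ::
  "('a::topological_space set \<Rightarrow> complex) \<Rightarrow> ('a \<Rightarrow> complex) \<Rightarrow> complex" where
  "cmeasure_integral \<mu> f =
     signed_integral (\<lambda>A. Re (\<mu> A)) f + \<i> * signed_integral (\<lambda>A. Im (\<mu> A)) f"

text \<open>
  The integral runs over the whole plane; for a measure supported on \<open>\<Gamma>\<close> this is the
  integral over \<open>\<Gamma>\<close>.
\<close>

definition fourier_transform :: "((real \<times> real) set \<Rightarrow> complex) \<Rightarrow> real \<times> real \<Rightarrow> complex" where
  "fourier_transform \<mu> x =
     cmeasure_integral \<mu>
       (\<lambda>y. exp (\<i> * complex_of_real (pi * (fst x * fst y + snd x * snd y))))"

text \<open>
  \<open>\<Gamma>\<close> is a finite disjoint union of smooth curves, parametrized by \<open>\<gamma>\<close>: each of the finitely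
  many components of the parameter set \<open>I\<close> is a nondegenerate interval and parametrizes one
  curve. The function \<open>D n\<close> is the \<open>n\<close>-th derivative of \<open>\<gamma>\<close> on \<open>I\<close>.
\<close>

definition smooth_curves_param :: "(real \<times> real) set \<Rightarrow> real set \<Rightarrow> (real \<Rightarrow> real \<times> real) \<Rightarrow> bool" where
  "smooth_curves_param \<Gamma> I \<gamma> \<longleftrightarrow>
     finite (components I) \<and> (\<forall>C\<in>components I. infinite C) \<and>
     inj_on \<gamma> I \<and> \<gamma> ` I = \<Gamma> \<and>
     (\<exists>D :: nat \<Rightarrow> real \<Rightarrow> real \<times> real. D 0 = \<gamma> \<and>
        (\<forall>n. \<forall>t\<in>I. (D n has_vector_derivative D (Suc n) t) (at t within I)) \<and>
        (\<forall>t\<in>I. D 1 t \<noteq> 0))"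

text \<open>
  The arc length measure \<open>A \<mapsto> \<integral>\<^bsub>{t \<in> I. \<gamma>(t) \<in> A}\<^esub> |\<gamma>'(t)| dt\<close>.
\<close>

definition arc_length_measure :: "real set \<Rightarrow> (real \<Rightarrow> real \<times> real) \<Rightarrow> (real \<times> real) measure" where
  "arc_length_measure I \<gamma> =
     distr (density (restrict_space lborel I)
              (\<lambda>t. ennreal (norm (vector_derivative \<gamma> (at t within I))))) borel \<gamma>"

text \<open>
  Arc length depends only on \<open>\<Gamma>\<close>: all parametrizations in the sense above induce the same
  measure (injectivity rules out multiplicities), so it does not matter which of them
  witnesses the existential quantifier.
\<close>

definition abs_cont_arc_length :: "(real \<times> real) set \<Rightarrow> ((real \<times> real) set \<Rightarrow> complex) \<Rightarrow> bool" where
  "abs_cont_arc_length \<Gamma> \<mu> \<longleftrightarrow>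
     (\<exists>I \<gamma>. smooth_curves_param \<Gamma> I \<gamma> \<and>
        (\<forall>A\<in>null_sets (arc_length_measure I \<gamma>). \<mu> A = 0))"

definition AC :: "(real \<times> real) set \<Rightarrow> (real \<times> real) set \<Rightarrow> ((real \<times> real) set \<Rightarrow> complex) set" where
  "AC \<Gamma> \<Lambda> = {\<mu>. complex_borel_measure \<mu> \<and>
     (\<forall>A\<in>sets borel. A \<inter> \<Gamma> = {} \<longrightarrow> \<mu> A = 0) \<and>
     abs_cont_arc_length \<Gamma> \<mu> \<and>
     (\<forall>x\<in>\<Lambda>. fourier_transform \<mu> x = 0)}"

definition lattice_cross :: "real \<Rightarrow> real \<Rightarrow> (real \<times> real) set" where
  "lattice_cross \<alpha> \<beta> =
     range (\<lambda>m::int. \<alpha> * of_int m) \<times> {0} \<union> {0} \<times> range (\<lambda>n::int. \<beta> * of_int n)"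

definition scale_setfun :: "complex \<Rightarrow> ('a set \<Rightarrow> complex) \<Rightarrow> 'a set \<Rightarrow> complex" where
  "scale_setfun c \<mu> = (\<lambda>A. c * \<mu> A)"

interpretation setfun: vector_space scale_setfun
  by unfold_locales (auto simp: scale_setfun_def fun_eq_iff algebra_simps)

text \<open>
  \<open>V\<close> lies in no finitely generated subspace; for a linear subspace \<open>V\<close> this says that
  \<open>V\<close> has infinite dimension over the complex numbers.
\<close>

definition infinite_dimensional :: "('a set \<Rightarrow> complex) set \<Rightarrow> bool" where
  "infinite_dimensional V \<longleftrightarrow> \<not> (\<exists>B. finite B \<and> V \<subseteq> setfun.span B)"

end

theory Submission
  imports Defs
begin

text \<open>
  Parametrize the hyperbola by \<open>t \<mapsto> (t, 1/t)\<close> and rescale so that the cross becomes \<open>\<int> \<times> {0} \<union> {0} \<times> c\<int>\<close>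
  with \<open>c = \<alpha>\<beta> > 1\<close>. A density \<open>f\<close> is then admissible iff both \<open>f\<close> and its flip
  \<open>y \<mapsto> c/y\<^sup>2 f(c/y)\<close> have vanishing 2-periodization. If the flip of \<open>f\<close> is \<open>- f\<close>, one condition suffices.
  Prescribe an anti-invariant \<open>h\<close> supported in the gap \<open>b < |t| < c/b\<close>, where \<open>1 < b\<close> and \<open>b\<^sup>2 < c\<close>,
  and look for \<open>f = A - flip A + h\<close> with \<open>A\<close> supported in \<open>[-b, b]\<close>. With a \<open>C\<^sup>1\<close> cutoff whose translates
  by \<open>2\<int>\<close> add up to 1, it is enough that \<open>A - Q A\<close> equals a given \<open>C\<^sup>1\<close> function, where \<open>Q\<close> (called \<open>transfer\<close>) flips,
  periodizes and cuts off. The operator \<open>Q\<close> does not increase the \<open>L\<^sup>1\<close> norm, and because \<open>t \<mapsto> c/t\<close> is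
  uniformly expanding on \<open>[-b, b]\<close> it satisfies the Lasota-Yorke inequality
  \<open>\<parallel>(Q g)'\<parallel>\<^sub>1 \<le> b\<^sup>2/c \<parallel>g'\<parallel>\<^sub>1 + C \<parallel>g\<parallel>\<^sub>1\<close>. Hence a power of \<open>Q\<close> is a finite rank operator (interpolation on a
  fine grid, then \<open>Q\<^sup>m\<close>) plus a contraction for \<open>\<parallel>g'\<parallel>\<^sub>1\<close>. A Neumann series solves the equation up to finitely
  many linear obstructions, and these cannot exhaust the infinitely many choices of \<open>h\<close>.
\<close>

section \<open>Compactly supported continuously differentiable functions\<close>

definition C1_supp :: "real \<Rightarrow> (real \<Rightarrow> real) \<Rightarrow> bool" where
  "C1_supp r g \<longleftrightarrow> (\<forall>x. (g has_real_derivative deriv g x) (at x)) \<and> continuous_on UNIV (deriv g) \<and>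
     (\<forall>x. r \<le> \<bar>x\<bar> \<longrightarrow> g x = 0 \<and> deriv g x = 0)"

lemma C1_suppI:
  assumes "\<And>x. (g has_real_derivative g' x) (at x)" "continuous_on UNIV g'"
    and "\<And>x. r \<le> \<bar>x\<bar> \<Longrightarrow> g x = 0" "\<And>x. r \<le> \<bar>x\<bar> \<Longrightarrow> g' x = 0"
  shows "C1_supp r g" "deriv g = g'"
proof -
  show *: "deriv g = g'"
    using assms(1) by (auto simp: fun_eq_iff intro!: DERIV_imp_deriv)
  show "C1_supp r g"
    unfolding C1_supp_def * using assms by auto
qed

lemma C1_supp_DERIV: "C1_supp r g \<Longrightarrow> (g has_real_derivative deriv g x) (at x)"
  and C1_supp_cont_deriv: "C1_supp r g \<Longrightarrow> continuous_on UNIV (deriv g)"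
  and C1_supp_zero: "C1_supp r g \<Longrightarrow> r \<le> \<bar>x\<bar> \<Longrightarrow> g x = 0"
  and C1_supp_deriv_zero: "C1_supp r g \<Longrightarrow> r \<le> \<bar>x\<bar> \<Longrightarrow> deriv g x = 0"
  by (auto simp: C1_supp_def)

lemma C1_supp_cont: "C1_supp r g \<Longrightarrow> continuous_on UNIV g"
  by (meson C1_supp_DERIV DERIV_isCont continuous_at_imp_continuous_on)

text \<open>The one form \<open>g x + a * h x\<close> serves for sums, differences and multiples
  alike; \<open>a = - 1\<close> explains the factors \<open>(- 1)\<close> further on.\<close>

lemma C1_supp_lincomb:
  assumes "C1_supp r g" "C1_supp r h"
  shows "C1_supp r (\<lambda>x. g x + a * h x)" "deriv (\<lambda>x. g x + a * h x) = (\<lambda>x. deriv g x + a * deriv h x)"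
proof -
  have d: "\<And>x. ((\<lambda>x. g x + a * h x) has_real_derivative deriv g x + a * deriv h x) (at x)"
    by (auto intro!: derivative_eq_intros C1_supp_DERIV[OF assms(1)] C1_supp_DERIV[OF assms(2)])
  have c: "continuous_on UNIV (\<lambda>x. deriv g x + a * deriv h x)"
    by (intro continuous_intros C1_supp_cont_deriv[OF assms(1)] C1_supp_cont_deriv[OF assms(2)])
  show "C1_supp r (\<lambda>x. g x + a * h x)" "deriv (\<lambda>x. g x + a * h x) = (\<lambda>x. deriv g x + a * deriv h x)"
    using C1_suppI[OF d c, of r] by (auto simp: C1_supp_zero[OF assms(1)] C1_supp_zero[OF assms(2)]
        C1_supp_deriv_zero[OF assms(1)] C1_supp_deriv_zero[OF assms(2)])
qed

lemma C1_supp_0: "C1_supp r (\<lambda>x. 0)"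
  by (rule C1_suppI(1)[where g'="\<lambda>x. 0"]) auto

lemma C1_supp_sum:
  assumes "finite I" "\<And>i. i \<in> I \<Longrightarrow> C1_supp r (g i)"
  shows "C1_supp r (\<lambda>x. \<Sum>i\<in>I. a i * g i x)"
  using assms
proof (induction I rule: finite_induct)
  case empty
  then show ?case by (simp add: C1_supp_0)
next
  case (insert i I)
  then have "C1_supp r (\<lambda>x. (\<Sum>i\<in>I. a i * g i x) + a i * g i x)"
    by (intro C1_supp_lincomb) auto
  then show ?case using insert by (simp add: add.commute)
qed

text \<open>Bridges the Lebesgue integral over the line, used for norms and unfolding, and the gauge
  integral over an interval, used with the fundamental theorem of calculus.\<close>

lemma integral_compact_support:
  fixes H :: "real \<Rightarrow> real"
  assumes c: "continuous_on UNIV H" and z: "\<And>x. r \<le> \<bar>x\<bar> \<Longrightarrow> H x = 0"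
  shows "integrable lborel H" "(\<integral>x. H x \<partial>lborel) = integral {-r..r} H"
proof -
  have e: "(\<lambda>x. indicator {-r..r} x *\<^sub>R H x) = H"
    using z by (force simp: fun_eq_iff indicator_def)
  have "set_integrable lborel {-r..r} H"
    unfolding set_integrable_def
    by (rule borel_integrable_compact) (auto intro: continuous_on_subset[OF c])
  then show "integrable lborel H" "(\<integral>x. H x \<partial>lborel) = integral {-r..r} H"
    using set_borel_integral_eq_integral(2)[of "{-r..r}" H] e
    by (auto simp: set_integrable_def set_lebesgue_integral_def)
qed

text \<open>For \<open>C1_supp\<close> functions this is the total variation, and by
  \<open>C1_supp_sup_le_tv\<close> a norm. It is the strong norm of the Lasota-Yorke argument,
  \<open>L1norm\<close> the weak one.\<close>

definition tv :: "(real \<Rightarrow> real) \<Rightarrow> real" where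
  "tv g = (\<integral>x. \<bar>deriv g x\<bar> \<partial>lborel)"

definition L1norm :: "(real \<Rightarrow> real) \<Rightarrow> real" where
  "L1norm g = (\<integral>x. \<bar>g x\<bar> \<partial>lborel)"

lemma tv_nonneg: "0 \<le> tv g" and L1norm_nonneg: "0 \<le> L1norm g"
  by (auto simp: tv_def L1norm_def)

lemma C1_supp_integrable:
  assumes "C1_supp r g"
  shows "integrable lborel g" "integrable lborel (\<lambda>x. \<bar>deriv g x\<bar>)" "integrable lborel (\<lambda>x. \<bar>g x\<bar>)"
    "tv g = integral {-r..r} (\<lambda>x. \<bar>deriv g x\<bar>)" "L1norm g = integral {-r..r} (\<lambda>x. \<bar>g x\<bar>)"
    "g \<in> borel_measurable borel"
proof -
  have 1: "continuous_on UNIV (\<lambda>x. \<bar>deriv g x\<bar>)" "continuous_on UNIV (\<lambda>x. \<bar>g x\<bar>)"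
    by (intro continuous_intros C1_supp_cont[OF assms] C1_supp_cont_deriv[OF assms])+
  note z = C1_supp_zero[OF assms] C1_supp_deriv_zero[OF assms]
  show "integrable lborel g" "integrable lborel (\<lambda>x. \<bar>deriv g x\<bar>)" "integrable lborel (\<lambda>x. \<bar>g x\<bar>)"
    "tv g = integral {-r..r} (\<lambda>x. \<bar>deriv g x\<bar>)" "L1norm g = integral {-r..r} (\<lambda>x. \<bar>g x\<bar>)"
    unfolding tv_def L1norm_def
    using integral_compact_support[OF 1(1), of r] integral_compact_support[OF 1(2), of r]
        integral_compact_support[OF C1_supp_cont[OF assms], of r] z by auto
  show "g \<in> borel_measurable borel"
    by (rule borel_measurable_continuous_onI[OF C1_supp_cont[OF assms]])
qed

text \<open>Fundamental theorem of calculus, then enlargement of the interval. The larger interval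
  is the whole support in one use and a single grid cell in others.\<close>

lemma C1_supp_diff_le_integral:
  assumes "C1_supp r g" "x \<le> y" "{x..y} \<subseteq> {u..v}"
  shows "\<bar>g y - g x\<bar> \<le> integral {u..v} (\<lambda>x. \<bar>deriv g x\<bar>)"
proof -
  have "(deriv g has_integral (g y - g x)) {x..y}"
    by (rule fundamental_theorem_of_calculus[OF assms(2)])
      (meson C1_supp_DERIV[OF assms(1)] has_real_derivative_iff_has_vector_derivative has_vector_derivative_at_within)
  then have "\<bar>g y - g x\<bar> = \<bar>integral {x..y} (deriv g)\<bar>" by (simp add: integral_unique)
  also have "\<dots> \<le> integral {x..y} (\<lambda>x. \<bar>deriv g x\<bar>)"
    using integral_norm_bound_integral[of "deriv g" "{x..y}" "\<lambda>x. \<bar>deriv g x\<bar>"]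
    by (auto intro!: integrable_continuous_real continuous_intros
        continuous_on_subset[OF C1_supp_cont_deriv[OF assms(1)]])
  also have "\<dots> \<le> integral {u..v} (\<lambda>x. \<bar>deriv g x\<bar>)"
    by (rule integral_subset_le[OF assms(3)])
      (auto intro!: integrable_continuous_real continuous_intros
        continuous_on_subset[OF C1_supp_cont_deriv[OF assms(1)]])
  finally show ?thesis .
qed

lemma C1_supp_sup_le_tv:
  assumes "C1_supp r g"
  shows "\<bar>g x\<bar> \<le> tv g"
proof (cases "r \<le> \<bar>x\<bar>")
  case True
  then show ?thesis by (simp add: C1_supp_zero[OF assms] tv_nonneg)
next
  case False
  then have "\<bar>g x - g (-r)\<bar> \<le> integral {-r..r} (\<lambda>x. \<bar>deriv g x\<bar>)"
    by (intro C1_supp_diff_le_integral[OF assms]) auto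
  then show ?thesis by (simp add: C1_supp_zero[OF assms] C1_supp_integrable(4)[OF assms])
qed

lemma C1_supp_L1norm_le_tv:
  assumes "C1_supp r g" "0 \<le> r"
  shows "L1norm g \<le> 2 * r * tv g"
proof -
  have "L1norm g = integral {-r..r} (\<lambda>x. \<bar>g x\<bar>)" by (rule C1_supp_integrable[OF assms(1)])
  also have "\<dots> \<le> integral {-r..r} (\<lambda>x. tv g)"
    by (rule integral_le)
      (auto intro!: integrable_continuous_real continuous_intros C1_supp_sup_le_tv[OF assms(1)]
        continuous_on_subset[OF C1_supp_cont[OF assms(1)]])
  also have "\<dots> = 2 * r * tv g" using assms(2) by simp
  finally show ?thesis .
qed

lemma tv_lincomb_le:
  assumes "C1_supp r g" "C1_supp r h"
  shows "tv (\<lambda>x. g x + a * h x) \<le> tv g + \<bar>a\<bar> * tv h"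
proof -
  have "tv (\<lambda>x. g x + a * h x) \<le> (\<integral>x. \<bar>deriv g x\<bar> + \<bar>a\<bar> * \<bar>deriv h x\<bar> \<partial>lborel)"
    unfolding tv_def C1_supp_lincomb(2)[OF assms]
    using C1_supp_integrable(2)[OF C1_supp_lincomb(1)[OF assms, of a]] C1_supp_lincomb(2)[OF assms]
    by (intro integral_mono)
       (auto intro!: C1_supp_integrable(2)[OF assms(1)] C1_supp_integrable(2)[OF assms(2)]
         Bochner_Integration.integrable_add
         Bochner_Integration.integrable_mult_right abs_triangle_ineq[THEN order_trans] simp: abs_mult)
  also have "\<dots> = tv g + \<bar>a\<bar> * tv h"
    unfolding tv_def by (simp add: C1_supp_integrable[OF assms(1)] C1_supp_integrable[OF assms(2)])
  finally show ?thesis .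
qed

section \<open>C^1 steps from truncated quadratics\<close>

definition pos2 :: "real \<Rightarrow> real" where "pos2 x = (max 0 x)^2"

lemma pos2_DERIV: "(pos2 has_real_derivative 2 * max 0 x) (at x)"
proof -
  consider "x < 0" | "x > 0" | "x = 0" by linarith
  then show ?thesis
  proof cases
    case 1
    have "((\<lambda>x. 0) has_real_derivative 2 * max 0 x) (at x)" using 1 by simp
    then show ?thesis
      by (rule has_field_derivative_transform_within_open[where S="{..<0}"]) (use 1 in \<open>auto simp: pos2_def\<close>)
  next
    case 2
    have "((\<lambda>x. x^2) has_real_derivative 2 * max 0 x) (at x)"
      using 2 by (auto intro!: derivative_eq_intros)
    then show ?thesis
      by (rule has_field_derivative_transform_within_open[where S="{0<..}"]) (use 2 in \<open>auto simp: pos2_def\<close>)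
  next
    case 3
    \<comment> \<open>The factored difference quotient of \<open>pos2\<close> at 0: the second
      factor is at most 1 in modulus, so the quotient is bounded by |h|.\<close>
    have "((\<lambda>h. max 0 h * (max 0 h / h)) \<longlongrightarrow> 0) (at (0::real))"
    proof (rule Lim_null_comparison)
      show "\<forall>\<^sub>F h in at 0. norm (max 0 h * (max 0 h / h)) \<le> \<bar>h\<bar>"
        by (rule always_eventually) (auto simp: max_def)
      show "((\<lambda>h. \<bar>h\<bar>) \<longlongrightarrow> 0) (at (0::real))"
        by (auto intro!: tendsto_eq_intros)
    qed
    then have "((\<lambda>h. (pos2 (0 + h) - pos2 0) / h) \<longlongrightarrow> 0) (at 0)"
      by (simp add: pos2_def power2_eq_square)
    then show ?thesis using 3 by (simp add: DERIV_def)
  qed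
qed

text \<open>The derivative is a tent of area 1 over the unit interval.\<close>

definition sstep :: "real \<Rightarrow> real" where
  "sstep x = 2 * (pos2 x - 2 * pos2 (x - 1/2) + pos2 (x - 1))"

definition sstep' :: "real \<Rightarrow> real" where
  "sstep' x = 4 * (max 0 x - 2 * max 0 (x - 1/2) + max 0 (x - 1))"

lemma sstep_DERIV: "(sstep has_real_derivative sstep' x) (at x)"
proof -
  have s: "((\<lambda>x. pos2 (x - a)) has_real_derivative 2 * max 0 (x - a)) (at x)" for a
  proof -
    have "((\<lambda>x. x - a) has_real_derivative 1) (at x)" by (auto intro!: derivative_eq_intros)
    from DERIV_chain2[OF pos2_DERIV this] show ?thesis by simp
  qed
  have "((\<lambda>x. 2 * (pos2 (x - 0) - 2 * pos2 (x - 1/2) + pos2 (x - 1))) has_real_derivative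
     2 * (2 * max 0 (x - 0) - 2 * (2 * max 0 (x - 1/2)) + 2 * max 0 (x - 1))) (at x)"
    by (intro DERIV_cmult DERIV_add DERIV_diff s)
  then show ?thesis
    unfolding sstep_def[abs_def] sstep'_def by (simp add: algebra_simps)
qed

lemma sstep_left: "x \<le> 0 \<Longrightarrow> sstep x = 0" and sstep_right: "1 \<le> x \<Longrightarrow> sstep x = 1"
  and sstep'_left: "x \<le> 0 \<Longrightarrow> sstep' x = 0" and sstep'_right: "1 \<le> x \<Longrightarrow> sstep' x = 0"
  and sstep'_nonneg: "0 \<le> sstep' x" and sstep'_le: "sstep' x \<le> 2"
  by (auto simp: sstep_def sstep'_def pos2_def power2_eq_square max_def algebra_simps)

lemma sstep_mono: "x \<le> y \<Longrightarrow> sstep x \<le> sstep y"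
  by (rule DERIV_nonneg_imp_nondecreasing) (use sstep_DERIV sstep'_nonneg in auto)

lemma sstep_affine_DERIV:
  "((\<lambda>x. sstep ((x - a) / h)) has_real_derivative sstep' ((x - a) / h) / h) (at x)"
proof -
  have "((\<lambda>x. (x - a) / h) has_real_derivative 1 / h) (at x)"
    by (auto intro!: derivative_eq_intros simp: divide_inverse)
  from DERIV_chain2[OF sstep_DERIV this] show ?thesis by simp
qed

lemma sstep'_affine_cont: "continuous_on UNIV (\<lambda>x. sstep' ((x - a) / h) / h)"
  unfolding sstep'_def[abs_def] divide_inverse by (intro continuous_intros)

section \<open>Periodization\<close>

text \<open>Strong enough for locally uniform convergence of the sum over translates, weak enough to
  hold for the flip of a compactly supported C^1 function, whose tail is of order
  \<open>1 / x^2\<close>.\<close>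

definition quad_decay :: "(real \<Rightarrow> real) \<Rightarrow> bool" where
  "quad_decay H \<longleftrightarrow> (\<exists>K\<ge>0. \<forall>x. \<bar>H x\<bar> \<le> K / (1 + x^2))"

text \<open>Pairing the translates by \<open>2k\<close> and \<open>-2k\<close> with
  \<open>k = Suc n\<close> turns a sum over nonzero integers into a series over \<open>nat\<close>;
  the untranslated term is kept apart.\<close>

definition per_term :: "(real \<Rightarrow> 'a::real_normed_vector) \<Rightarrow> nat \<Rightarrow> real \<Rightarrow> 'a" where
  "per_term H n x = H (x + 2 * real (Suc n)) + H (x - 2 * real (Suc n))"

text \<open>The step 2 is the common period of the characters \<open>exp (i pi m x)\<close>, which
  inherit the factor pi from the Fourier transform.\<close>

definition periodize :: "(real \<Rightarrow> 'a::real_normed_vector) \<Rightarrow> real \<Rightarrow> 'a" where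
  "periodize H x = H x + (\<Sum>n. per_term H n x)"

text \<open>Peetre's inequality: since \<open>t = (x + t) - x\<close>, the weight
  \<open>1 + t^2\<close> is at most twice the product of the weights at \<open>x\<close> and
  \<open>x + t\<close>. Decay thus survives a translation at the cost of a factor in
  \<open>x\<close> alone.\<close>

lemma quad_decay_shift_bound:
  fixes x t :: real
  assumes "\<And>x. \<bar>H x\<bar> \<le> K / (1 + x^2)" "0 \<le> K"
  shows "\<bar>H (x + t)\<bar> \<le> 2 * K * (1 + x^2) / (1 + t^2)"
proof -
  have *: "1 + t^2 \<le> 2 * (1 + x^2) * (1 + (x + t)^2)"
  proof -
    have "t^2 \<le> 2 * x^2 + 2 * (x + t)^2"
      using sum_squares_ge_zero[of "2 * x + t" 0] by (simp add: power2_eq_square algebra_simps)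
    moreover have "0 \<le> x^2 * (x+t)^2" by simp
    moreover have "2 * (1 + x^2) * (1 + (x + t)^2) = 2 + 2 * x^2 + 2 * (x+t)^2 + 2 * (x^2 * (x+t)^2)"
      by (simp add: algebra_simps)
    ultimately show ?thesis by linarith
  qed
  have "\<bar>H (x + t)\<bar> \<le> K / (1 + (x + t)^2)" by (rule assms)
  also have "\<dots> \<le> K * (2 * (1 + x^2) / (1 + t^2))"
    using * assms(2) unfolding divide_inverse[of K]
    by (intro mult_left_mono) (auto simp: field_simps add_pos_nonneg)
  finally show ?thesis by (simp add: algebra_simps)
qed

text \<open>Majorants uniform in |x| <= r with an inverse-square series in \<open>n\<close>. The
  one-sided bounds serve the unfolding, where translates are shifted separately; the last one serves
  convergence of the periodization.\<close>

lemma per_term_bound: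
  fixes H :: "real \<Rightarrow> real"
  assumes "quad_decay H"
  obtains K where "0 \<le> K" "\<And>n (x::real) r. \<bar>x\<bar> \<le> r \<Longrightarrow>
     \<bar>H (x + 2 * real (Suc n))\<bar> \<le> K * (1 + r^2) * inverse (real (Suc n) ^ 2)"
    "\<And>n (x::real) r. \<bar>x\<bar> \<le> r \<Longrightarrow> \<bar>H (x - 2 * real (Suc n))\<bar> \<le> K * (1 + r^2) * inverse (real (Suc n) ^ 2)"
    "\<And>n (x::real) r. \<bar>x\<bar> \<le> r \<Longrightarrow> \<bar>per_term H n x\<bar> \<le> 2 * K * (1 + r^2) * inverse (real (Suc n) ^ 2)"
proof -
  obtain K where K: "\<And>x. \<bar>H x\<bar> \<le> K / (1 + x^2)" "0 \<le> K"
    using assms by (auto simp: quad_decay_def)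
  have b: "\<bar>H (x + t)\<bar> \<le> 2 * K * (1 + r^2) * inverse (real (Suc n) ^ 2)"
    if "\<bar>x\<bar> \<le> r" "\<bar>t\<bar> = 2 * real (Suc n)" for x r t n
  proof -
    have "\<bar>H (x + t)\<bar> \<le> 2 * K * (1 + x^2) / (1 + t^2)" by (rule quad_decay_shift_bound[OF K])
    also have "\<dots> \<le> 2 * K * (1 + r^2) / (real (Suc n) ^ 2)"
    proof (intro frac_le mult_left_mono)
      have "x^2 \<le> r^2" using that(1) by (metis power2_abs power_mono abs_ge_zero)
      then show "1 + x^2 \<le> 1 + r^2" by simp
      have "t^2 = (2 * real (Suc n))^2" using that(2) by (metis power2_abs)
      then show "(real (Suc n))^2 \<le> 1 + t^2" by (simp add: power2_eq_square algebra_simps)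
    qed (use K(2) in \<open>auto\<close>)
    finally show ?thesis by (simp add: divide_inverse)
  qed
  show ?thesis
  proof (rule that[of "2 * K"])
    fix n and x r :: real assume x: "\<bar>x\<bar> \<le> r"
    show 1: "\<bar>H (x + 2 * real (Suc n))\<bar> \<le> 2 * K * (1 + r^2) * inverse (real (Suc n) ^ 2)"
      by (rule b[OF x]) simp
    show 2: "\<bar>H (x - 2 * real (Suc n))\<bar> \<le> 2 * K * (1 + r^2) * inverse (real (Suc n) ^ 2)"
      using b[OF x, of "- (2 * real (Suc n))" n] by (simp del: of_nat_Suc)
    show "\<bar>per_term H n x\<bar> \<le> 2 * (2 * K) * (1 + r^2) * inverse (real (Suc n) ^ 2)"
      using 1 2 unfolding per_term_def by linarith
  qed (use K in auto)
qed

lemma summable_inv_Suc_sq: "summable (\<lambda>n. C * inverse (real (Suc n) ^ 2))"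
  by (intro summable_mult, subst summable_Suc_iff[where f="\<lambda>n. inverse (real n ^ 2)"])
     (rule inverse_power_summable, simp)

lemma per_term_summable:
  assumes "quad_decay H"
  shows "summable (\<lambda>n. per_term H n x)" "summable (\<lambda>n. \<bar>per_term H n x\<bar>)"
proof -
  obtain K where K: "\<And>n (x::real) r. \<bar>x\<bar> \<le> r \<Longrightarrow> \<bar>per_term H n x\<bar> \<le> 2 * K * (1 + r^2) * inverse (real (Suc n) ^ 2)"
    using per_term_bound[OF assms] by metis
  show "summable (\<lambda>n. \<bar>per_term H n x\<bar>)"
    by (rule summable_comparison_test'[OF summable_inv_Suc_sq[of "2 * K * (1 + \<bar>x\<bar>^2)"], of 0])
       (use K[of x "\<bar>x\<bar>"] in auto)
  then show "summable (\<lambda>n. per_term H n x)" by (rule summable_rabs_cancel)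
qed

lemma periodize_sums: "quad_decay H \<Longrightarrow> (\<lambda>n. per_term H n x) sums (periodize H x - H x)"
  unfolding periodize_def using summable_sums[OF per_term_summable(1)] by simp

lemma periodize_eqI: "(\<lambda>n. per_term H n x) sums s \<Longrightarrow> periodize H x = H x + s"
  by (auto simp: periodize_def sums_iff)

lemma quad_decay_lincomb: "quad_decay G \<Longrightarrow> quad_decay H \<Longrightarrow> quad_decay (\<lambda>x. G x + a * H x)"
proof -
  assume "quad_decay G" "quad_decay H"
  then obtain K L where K: "K \<ge> 0" "\<And>x. \<bar>G x\<bar> \<le> K / (1 + x^2)" and L: "L \<ge> 0" "\<And>x. \<bar>H x\<bar> \<le> L / (1 + x^2)"
    by (auto simp: quad_decay_def)
  show ?thesis unfolding quad_decay_def
  proof (intro exI[of _ "K + \<bar>a\<bar> * L"] conjI allI)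
    fix x
    have "\<bar>G x + a * H x\<bar> \<le> \<bar>G x\<bar> + \<bar>a\<bar> * \<bar>H x\<bar>" by (metis abs_mult abs_triangle_ineq)
    also have "\<dots> \<le> K / (1 + x^2) + \<bar>a\<bar> * (L / (1 + x^2))"
      by (intro add_mono K mult_left_mono L) auto
    finally show "\<bar>G x + a * H x\<bar> \<le> (K + \<bar>a\<bar> * L) / (1 + x^2)" by (simp add: add_divide_distrib)
  qed (use K L in auto)
qed

lemma periodize_lincomb:
  assumes "quad_decay G" "quad_decay H"
  shows "periodize (\<lambda>x. G x + a * H x) x = periodize G x + a * periodize H x"
proof -
  have "(\<lambda>n. per_term (\<lambda>x. G x + a * H x) n x) sums ((periodize G x - G x) + a * (periodize H x - H x))"
    using sums_add[OF periodize_sums[OF assms(1), of x] sums_mult[OF periodize_sums[OF assms(2), of x], of a]]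
    by (simp add: per_term_def algebra_simps)
  then show ?thesis by (simp add: periodize_eqI algebra_simps)
qed

lemma quad_decay_abs: "quad_decay H \<Longrightarrow> quad_decay (\<lambda>x. \<bar>H x\<bar>)"
  by (simp add: quad_decay_def)

lemma periodize_abs_le: "quad_decay H \<Longrightarrow> \<bar>periodize H x\<bar> \<le> periodize (\<lambda>x. \<bar>H x\<bar>) x"
proof -
  assume d: "quad_decay H"
  have "\<bar>periodize H x\<bar> \<le> \<bar>H x\<bar> + \<bar>\<Sum>n. per_term H n x\<bar>" unfolding periodize_def by (rule abs_triangle_ineq)
  also have "\<dots> \<le> \<bar>H x\<bar> + (\<Sum>n. \<bar>per_term H n x\<bar>)"
    using summable_rabs[OF per_term_summable(2)[OF d]] by simp
  also have "(\<Sum>n. \<bar>per_term H n x\<bar>) \<le> (\<Sum>n. per_term (\<lambda>x. \<bar>H x\<bar>) n x)"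
    by (intro suminf_le per_term_summable quad_decay_abs d) (simp add: per_term_def)
  finally show ?thesis by (simp add: periodize_def)
qed

lemma periodize_measurable [measurable]:
  assumes "H \<in> borel_measurable borel"
  shows "periodize (H :: real \<Rightarrow> 'a :: {banach, second_countable_topology}) \<in> borel_measurable borel"
proof -
  note [measurable] = assms
  show ?thesis unfolding periodize_def[abs_def] per_term_def by measurable
qed

text \<open>Termwise differentiation by the Weierstrass test. The majorants grow with
  \<open>r\<close>, so convergence is uniform on bounded intervals only; derivative and continuity
  are local, so this suffices.\<close>

lemma periodize_DERIV:
  assumes "\<And>x. (H has_real_derivative H' x) (at x)" "continuous_on UNIV H'" "quad_decay H" "quad_decay H'"
  shows "(periodize H has_real_derivative periodize H' x) (at x)" "continuous_on UNIV (periodize H')"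
proof -
  have d: "(per_term H n has_real_derivative per_term H' n x) (at x)" for n x
  proof -
    have "((\<lambda>x. H (x + a)) has_real_derivative H' (x + a)) (at x)" for a
      using DERIV_shift[of H "H' (x + a)" x a] assms(1) by simp
    from DERIV_add[OF this[of "2 * real (Suc n)"] this[of "- (2 * real (Suc n))"]]
    show ?thesis unfolding per_term_def[abs_def] by (simp only: diff_conv_add_uminus)
  qed
  have u: "uniformly_convergent_on {-r<..<r} (\<lambda>n x. \<Sum>i<n. per_term H' i x)"
    and ul: "uniform_limit {-r<..<r} (\<lambda>n x. \<Sum>i<n. per_term H' i x) (\<lambda>x. \<Sum>n. per_term H' n x) sequentially" for r
  proof -
    obtain K where K: "\<And>n (x::real) r. \<bar>x\<bar> \<le> r \<Longrightarrow> \<bar>per_term H' n x\<bar> \<le> 2 * K * (1 + r^2) * inverse (real (Suc n) ^ 2)"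
      using per_term_bound[OF assms(4)] by metis
    show "uniform_limit {-r<..<r} (\<lambda>n x. \<Sum>i<n. per_term H' i x) (\<lambda>x. \<Sum>n. per_term H' n x) sequentially"
      by (rule Weierstrass_m_test[OF _ summable_inv_Suc_sq[of "2 * K * (1 + r^2)"]])
        (use K[of _ r] in force)
    then show "uniformly_convergent_on {-r<..<r} (\<lambda>n x. \<Sum>i<n. per_term H' i x)"
      by (auto simp: uniformly_convergent_on_def)
  qed
  have "((\<lambda>x. \<Sum>n. per_term H n x) has_real_derivative (\<Sum>n. per_term H' n x)) (at x)" for x
    by (rule has_field_derivative_series'(2)[OF _ _ u[of "\<bar>x\<bar> + 1"], where ?x0.0=x])
       (auto intro!: per_term_summable(1) assms(3) has_field_derivative_at_within d convex_real_interval
         simp: interior_open)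
  then show "(periodize H has_real_derivative periodize H' x) (at x)"
    unfolding periodize_def[abs_def] by (intro DERIV_add assms(1))
  have c: "continuous_on UNIV (per_term H' n)" for n
    unfolding per_term_def[abs_def]
    by (intro continuous_intros continuous_on_compose2[OF assms(2)]) auto
  have "continuous_on {-r<..<r} (\<lambda>x. \<Sum>n. per_term H' n x)" for r
    by (rule uniform_limit_theorem[OF _ ul])
       (auto intro!: always_eventually continuous_on_sum continuous_on_subset[OF c])
  then have "isCont (\<lambda>x. \<Sum>n. per_term H' n x) x" for x
    using continuous_on_interior[of "{-(\<bar>x\<bar>+1)<..<\<bar>x\<bar>+1}" "\<lambda>x. \<Sum>n. per_term H' n x" x]
    by (simp only: interior_open[OF open_greaterThanLessThan]) (auto simp: abs_if)
  then have "continuous_on UNIV (\<lambda>x. \<Sum>n. per_term H' n x)"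
    by (simp add: continuous_at_imp_continuous_on)
  then show "continuous_on UNIV (periodize H')"
    unfolding periodize_def[abs_def] by (intro continuous_on_add assms(2))
qed

text \<open>Unfolding: the translates move from \<open>H\<close> to the weight \<open>w\<close>,
  whose periodization \<open>W\<close> appears on the other side. Both integrals are expanded into
  series whose terms agree by translation invariance. Leaving \<open>W\<close> as a given sum lets
  it be 1, 3 or a character.\<close>

lemma periodize_unfold:
  fixes w :: "real \<Rightarrow> 'a :: {banach, second_countable_topology}"
  assumes H: "quad_decay H" "H \<in> borel_measurable borel" "integrable lborel H"
    and w: "w \<in> borel_measurable borel" "\<And>x. norm (w x) \<le> M" "\<And>x. r \<le> \<bar>x\<bar> \<Longrightarrow> w x = 0"
    and W: "\<And>x. (\<lambda>n. per_term w n x) sums (W x - w x)"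
  shows "integrable lborel (\<lambda>x. periodize H x *\<^sub>R w x)" "integrable lborel (\<lambda>x. H x *\<^sub>R W x)"
    "(\<integral>x. periodize H x *\<^sub>R w x \<partial>lborel) = (\<integral>x. H x *\<^sub>R W x \<partial>lborel)"
proof -
  note [measurable] = H(2) w(1)
  have M: "0 \<le> M" using w(2)[of 0] norm_ge_zero order_trans by blast
  have wi: "integrable lborel (\<lambda>x. norm (w x))"
  proof (rule Bochner_Integration.integrable_bound)
    show "integrable lborel (\<lambda>x. M * indicator {-r..r} x)"
      by (intro integrable_mult_right integrable_real_indicator) (auto simp: emeasure_lborel_Icc_eq)
    have "norm (norm (w x)) \<le> norm (M * indicator {-r..r} x)" for x
    proof (cases "x \<in> {-r..r}")
      case True
      then show ?thesis using w(2)[of x] M by simp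
    next
      case False
      then have "w x = 0" by (intro w(3)) auto
      then show ?thesis by simp
    qed
    then show "AE x in lborel. norm (norm (w x)) \<le> norm (M * indicator {-r..r} x)" by simp
  qed simp
  have Hw: "integrable lborel (\<lambda>x. H x *\<^sub>R w (x + t))" for t
  proof (rule Bochner_Integration.integrable_bound)
    show "integrable lborel (\<lambda>x. M * H x)" using H(3) by simp
    show "AE x in lborel. norm (H x *\<^sub>R w (x + t)) \<le> norm (M * H x)"
    proof (intro always_eventually allI)
      fix x
      have "norm (H x *\<^sub>R w (x + t)) \<le> \<bar>H x\<bar> * M"
        unfolding norm_scaleR by (rule mult_left_mono) (use w(2) in auto)
      then show "norm (H x *\<^sub>R w (x + t)) \<le> norm (M * H x)"
        using M by (simp add: abs_mult mult.commute)
    qed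
  qed simp
  have sh: "(\<integral>x. F (x + t) \<partial>lborel) = (\<integral>x. F x \<partial>lborel)"
    "integrable lborel (\<lambda>x. F (x + t)) \<longleftrightarrow> integrable lborel F"
    for F :: "real \<Rightarrow> 'b::{banach, second_countable_topology}" and t
    using lborel_integral_real_affine[of 1 F t] lborel_integrable_real_affine_iff[of 1 F t]
    by (simp_all add: add.commute)
  obtain K where K: "0 \<le> K" "\<And>n (x::real) r. \<bar>x\<bar> \<le> r \<Longrightarrow>
     \<bar>H (x + 2 * real (Suc n))\<bar> \<le> K * (1 + r^2) * inverse (real (Suc n) ^ 2)"
    "\<And>n (x::real) r. \<bar>x\<bar> \<le> r \<Longrightarrow> \<bar>H (x - 2 * real (Suc n))\<bar> \<le> K * (1 + r^2) * inverse (real (Suc n) ^ 2)"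
    using per_term_bound[OF H(1)] by metis
  define t where "t n = 2 * real (Suc n)" for n
  have Pt: "per_term f n x = f (x + t n) + f (x + - t n)" for f :: "real \<Rightarrow> 'c::real_normed_vector" and n x
    unfolding per_term_def t_def by (simp only: diff_conv_add_uminus)
  define C where "C = K * (1 + r^2) * (\<integral>x. norm (w x) \<partial>lborel)"
  \<comment> \<open>After a translation \<open>w\<close> is unshifted, so only |x| < r counts, and
    there the one-sided bounds for \<open>H\<close> are uniform.\<close>
  have Hwb: "(\<integral>x. norm (H x *\<^sub>R w (x + s)) \<partial>lborel) \<le> C * inverse (real (Suc n) ^ 2)"
    if "s = t n \<or> s = - t n" for n s
  proof -
    have "(\<integral>x. norm (H x *\<^sub>R w (x + s)) \<partial>lborel) = (\<integral>x. norm (H (x - s) *\<^sub>R w x) \<partial>lborel)"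
      using sh(1)[of "\<lambda>x. norm (H (x - s) *\<^sub>R w x)" s] by simp
    also have "\<dots> \<le> (\<integral>x. K * (1 + r^2) * inverse (real (Suc n) ^ 2) * norm (w x) \<partial>lborel)"
    proof (rule integral_mono)
      show "integrable lborel (\<lambda>x. norm (H (x - s) *\<^sub>R w x))"
        using integrable_norm[OF Hw[of s]] sh(2)[of "\<lambda>x. norm (H (x - s) *\<^sub>R w x)" s] by simp
      fix x
      show "norm (H (x - s) *\<^sub>R w x) \<le> K * (1 + r^2) * inverse (real (Suc n) ^ 2) * norm (w x)"
      proof (cases "r \<le> \<bar>x\<bar>")
        case False
        then have "\<bar>H (x - s)\<bar> \<le> K * (1 + r^2) * inverse (real (Suc n) ^ 2)"
          using that K(2)[of x r n] K(3)[of x r n]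
          by (elim disjE) (simp_all add: t_def del: of_nat_Suc)
        then show ?thesis by (auto intro: mult_right_mono)
      qed (simp add: w(3))
    qed (use wi in auto)
    finally show ?thesis by (simp add: C_def mult_ac)
  qed
  define F where "F n x = H x *\<^sub>R per_term w n x" for n x
  have Fi: "integrable lborel (F n)" for n
    unfolding F_def[abs_def] Pt scaleR_add_right by (intro Bochner_Integration.integrable_add Hw)
  have Fs: "summable (\<lambda>n. \<integral>x. norm (F n x) \<partial>lborel)"
  proof (rule summable_comparison_test'[OF summable_inv_Suc_sq[of "2 * C"], of 0])
    fix n
    have "(\<integral>x. norm (F n x) \<partial>lborel) \<le> (\<integral>x. norm (H x *\<^sub>R w (x + t n)) + norm (H x *\<^sub>R w (x + - t n)) \<partial>lborel)"
    proof (rule integral_mono)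
      show "norm (F n x) \<le> norm (H x *\<^sub>R w (x + t n)) + norm (H x *\<^sub>R w (x + - t n))" for x
        unfolding F_def Pt scaleR_add_right by (rule norm_triangle_ineq)
    qed (intro Fi Hw integrable_norm Bochner_Integration.integrable_add)+
    also have "\<dots> \<le> 2 * C * inverse (real (Suc n) ^ 2)"
      using Hwb[of "t n" n] Hwb[of "- t n" n]
      by (subst Bochner_Integration.integral_add[OF integrable_norm[OF Hw] integrable_norm[OF Hw]]) linarith
    finally show "norm (\<integral>x. norm (F n x) \<partial>lborel) \<le> 2 * C * inverse (real (Suc n) ^ 2)" by simp
  qed
  have Fp: "summable (\<lambda>n. norm (F n x))" for x
  proof -
    obtain N where N: "\<bar>x\<bar> + r < real N" using reals_Archimedean2 by blast
    have "F n x = 0" if "n \<notin> {..<N}" for n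
    proof -
      have "real N \<le> real n" using that by simp
      then have "w (x + 2 * real (Suc n)) = 0" "w (x - 2 * real (Suc n)) = 0"
        using N by (auto intro!: w(3))
      then show ?thesis by (simp add: F_def per_term_def)
    qed
    then show ?thesis by (intro summable_finite[of "{..<N}"]) auto
  qed
  have FW: "(\<Sum>n. F n x) = H x *\<^sub>R (W x - w x)" for x
    unfolding F_def using sums_scaleR_right[OF W, of "H x" x] by (simp add: sums_iff)
  have I1: "integrable lborel (\<lambda>x. H x *\<^sub>R (W x - w x))"
    "(\<integral>x. H x *\<^sub>R (W x - w x) \<partial>lborel) = (\<Sum>n. \<integral>x. F n x \<partial>lborel)"
    using integrable_suminf[OF Fi _ Fs] integral_suminf[OF Fi _ Fs] Fp FW by auto
  have Hw0: "integrable lborel (\<lambda>x. H x *\<^sub>R w x)" using Hw[of 0] by simp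
  show IW: "integrable lborel (\<lambda>x. H x *\<^sub>R W x)"
    using Bochner_Integration.integrable_add[OF I1(1) Hw0] by (simp add: algebra_simps)
  define G where "G n x = per_term H n x *\<^sub>R w x" for n x
  have Hw': "integrable lborel (\<lambda>x. H (x - s) *\<^sub>R w x)"
    "(\<integral>x. H (x - s) *\<^sub>R w x \<partial>lborel) = (\<integral>x. H x *\<^sub>R w (x + s) \<partial>lborel)"
    "(\<integral>x. norm (H (x - s) *\<^sub>R w x) \<partial>lborel) = (\<integral>x. norm (H x *\<^sub>R w (x + s)) \<partial>lborel)" for s
    using Hw[of s] sh[of "\<lambda>x. H (x - s) *\<^sub>R w x" s] sh(1)[of "\<lambda>x. norm (H (x - s) *\<^sub>R w x)" s] by simp_all
  have Gi: "integrable lborel (G n)" for n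
  proof -
    have "G n = (\<lambda>x. H (x - - t n) *\<^sub>R w x + H (x - t n) *\<^sub>R w x)"
      unfolding G_def Pt scaleR_add_left by simp
    then show ?thesis by (simp only:) (intro Bochner_Integration.integrable_add Hw')
  qed
  have Gs: "summable (\<lambda>n. \<integral>x. norm (G n x) \<partial>lborel)"
  proof (rule summable_comparison_test'[OF summable_inv_Suc_sq[of "2 * C"], of 0])
    fix n
    have "(\<integral>x. norm (G n x) \<partial>lborel) \<le> (\<integral>x. norm (H (x - t n) *\<^sub>R w x) + norm (H (x - (- t n)) *\<^sub>R w x) \<partial>lborel)"
    proof (rule integral_mono)
      fix x
      have "G n x = H (x - t n) *\<^sub>R w x + H (x - (- t n)) *\<^sub>R w x"
        unfolding G_def Pt scaleR_add_left by (simp add: add.commute)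
      then show "norm (G n x) \<le> norm (H (x - t n) *\<^sub>R w x) + norm (H (x - (- t n)) *\<^sub>R w x)"
        by (metis norm_triangle_ineq)
    qed (intro Gi Hw'(1) integrable_norm Bochner_Integration.integrable_add)+
    also have "\<dots> \<le> 2 * C * inverse (real (Suc n) ^ 2)"
      using Hwb[of "t n" n] Hwb[of "- t n" n] Hw'(3)[of "t n"] Hw'(3)[of "- t n"]
      by (subst Bochner_Integration.integral_add[OF integrable_norm[OF Hw'(1)] integrable_norm[OF Hw'(1)]]) linarith
    finally show "norm (\<integral>x. norm (G n x) \<partial>lborel) \<le> 2 * C * inverse (real (Suc n) ^ 2)" by simp
  qed
  have Gp: "summable (\<lambda>n. norm (G n x))" for x
    unfolding G_def norm_scaleR
    by (rule summable_mult2) (use per_term_summable(2)[OF H(1)] in auto)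
  have GP: "(\<Sum>n. G n x) = (periodize H x - H x) *\<^sub>R w x" for x
    unfolding G_def using sums_scaleR_left[OF periodize_sums[OF H(1)], of x "w x"] by (simp add: sums_iff)
  have I2: "integrable lborel (\<lambda>x. (periodize H x - H x) *\<^sub>R w x)"
    "(\<integral>x. (periodize H x - H x) *\<^sub>R w x \<partial>lborel) = (\<Sum>n. \<integral>x. G n x \<partial>lborel)"
    using integrable_suminf[OF Gi _ Gs] integral_suminf[OF Gi _ Gs] Gp GP by auto
  show IP: "integrable lborel (\<lambda>x. periodize H x *\<^sub>R w x)"
    using Bochner_Integration.integrable_add[OF I2(1) Hw0] by (simp add: algebra_simps)
  have FG: "(\<integral>x. F n x \<partial>lborel) = (\<integral>x. G n x \<partial>lborel)" for n
  proof -
    have "(\<integral>x. F n x \<partial>lborel) = (\<integral>x. H x *\<^sub>R w (x + t n) + H x *\<^sub>R w (x + - t n) \<partial>lborel)"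
      unfolding F_def Pt scaleR_add_right ..
    also have "\<dots> = (\<integral>x. H (x - t n) *\<^sub>R w x + H (x - (- t n)) *\<^sub>R w x \<partial>lborel)"
      by (simp only: Bochner_Integration.integral_add[OF Hw Hw] Bochner_Integration.integral_add[OF Hw'(1) Hw'(1)] Hw'(2))
    also have "\<dots> = (\<integral>x. G n x \<partial>lborel)"
      unfolding G_def Pt scaleR_add_left by (simp add: add.commute)
    finally show ?thesis .
  qed
  have "(\<integral>x. periodize H x *\<^sub>R w x \<partial>lborel) - (\<integral>x. H x *\<^sub>R w x \<partial>lborel) = (\<integral>x. (periodize H x - H x) *\<^sub>R w x \<partial>lborel)"
    using IP Hw0 by (simp add: scaleR_diff_left)
  also have "\<dots> = (\<integral>x. H x *\<^sub>R (W x - w x) \<partial>lborel)"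
    using I1 I2 FG by simp
  also have "\<dots> = (\<integral>x. H x *\<^sub>R W x \<partial>lborel) - (\<integral>x. H x *\<^sub>R w x \<partial>lborel)"
    using IW Hw0 by (simp add: scaleR_diff_right)
  finally show "(\<integral>x. periodize H x *\<^sub>R w x \<partial>lborel) = (\<integral>x. H x *\<^sub>R W x \<partial>lborel)" by simp
qed

section \<open>The flip\<close>

text \<open>The domain on which periodizing and cutting off works; it contains
  \<open>C1_supp\<close> functions and their flips.\<close>

definition C1_decay :: "(real \<Rightarrow> real) \<Rightarrow> bool" where
  "C1_decay H \<longleftrightarrow> (\<forall>x. (H has_real_derivative deriv H x) (at x)) \<and> continuous_on UNIV (deriv H) \<and>
     quad_decay H \<and> quad_decay (deriv H) \<and> integrable lborel H \<and> integrable lborel (deriv H)"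

lemma C1_decayI:
  assumes "\<And>x. (H has_real_derivative H' x) (at x)" "continuous_on UNIV H'" "quad_decay H" "quad_decay H'"
    "integrable lborel H" "integrable lborel H'"
  shows "C1_decay H" "deriv H = H'"
proof -
  show *: "deriv H = H'"
    using assms(1) by (auto simp: fun_eq_iff intro!: DERIV_imp_deriv)
  show "C1_decay H"
    unfolding C1_decay_def * using assms by auto
qed

lemma C1_decay_lincomb:
  assumes "C1_decay G" "C1_decay H"
  shows "C1_decay (\<lambda>x. G x + a * H x)"
proof (rule C1_decayI)
  show "((\<lambda>x. G x + a * H x) has_real_derivative deriv G x + a * deriv H x) (at x)" for x
    using assms by (auto intro!: derivative_eq_intros simp: C1_decay_def)
qed (use assms in \<open>auto simp: C1_decay_def intro!: quad_decay_lincomb continuous_intros\<close>)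

text \<open>Vanishing near 0 lets \<open>y^2\<close> be replaced by \<open>1 + y^2\<close> at the
  cost of the factor \<open>1 / d^2 + 1\<close>. A flipped compactly supported function is of this
  kind.\<close>

lemma quad_decay_outside:
  assumes "0 < d" "0 \<le> K" "\<And>y. \<bar>y\<bar> < d \<Longrightarrow> H y = 0" "\<And>y. d \<le> \<bar>y\<bar> \<Longrightarrow> \<bar>H y\<bar> \<le> K / y^2"
  shows "quad_decay H"
  unfolding quad_decay_def
proof (intro exI[of _ "K * (1 / d^2 + 1)"] conjI allI)
  fix y
  show "\<bar>H y\<bar> \<le> K * (1 / d^2 + 1) / (1 + y^2)"
  proof (cases "\<bar>y\<bar> < d")
    case True
    then show ?thesis using assms by simp
  next
    case False
    then have y: "y^2 > 0" "y^2 \<ge> d^2"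
      using assms(1) by (auto intro: power2_le_imp_le simp flip: abs_le_square_iff)
    have "1 \<le> y^2 / d^2" using y assms(1) by simp
    then have "1 + y^2 \<le> (1 / d^2 + 1) * y^2" by (simp add: algebra_simps)
    then have "1 / y^2 \<le> (1 / d^2 + 1) / (1 + y^2)"
      using y by (simp add: field_simps add_pos_pos)
    then have "K * (1 / y^2) \<le> K * ((1 / d^2 + 1) / (1 + y^2))"
      by (rule mult_left_mono) (rule assms(2))
    with assms(4)[of y] False show ?thesis by simp
  qed
qed (use assms in auto)

lemma compact_support_bounded:
  fixes H :: "real \<Rightarrow> real"
  assumes "continuous_on UNIV H" "\<And>x. r \<le> \<bar>x\<bar> \<Longrightarrow> H x = (0::real)"
  obtains B where "0 \<le> B" "\<And>x. \<bar>H x\<bar> \<le> B"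
proof -
  have "compact (H ` {-r..r})"
    by (intro compact_continuous_image continuous_on_subset[OF assms(1)]) auto
  then obtain B where B: "\<And>x. x \<in> {-r..r} \<Longrightarrow> \<bar>H x\<bar> \<le> B"
    using compact_imp_bounded bounded_iff by (metis imageI real_norm_def)
  have "\<bar>H x\<bar> \<le> max 0 B" for x
    using B[of x] assms(2)[of x] by (cases "x \<in> {-r..r}") auto
  then show ?thesis using that[of "max 0 B"] by simp
qed

lemma C1_supp_C1_decay:
  assumes "C1_supp r g"
  shows "C1_decay g"
proof -
  have "quad_decay H" if H: "continuous_on UNIV H" "\<And>x. r \<le> \<bar>x\<bar> \<Longrightarrow> H x = 0" for H
  proof -
    obtain B where B: "0 \<le> B" "\<And>x. \<bar>H x\<bar> \<le> B" using compact_support_bounded[OF H] by blast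
    have "\<bar>H x\<bar> \<le> B * (1 + r^2) / (1 + x^2)" for x
    proof (cases "r \<le> \<bar>x\<bar>")
      case False
      then have "x^2 \<le> r^2" by (metis abs_ge_zero linear power2_abs power_mono)
      then have "B * (1 + x^2) \<le> B * (1 + r^2)" using B by (intro mult_left_mono) auto
      moreover have "B * (1 + x^2) / (1 + x^2) = B"
        using sum_power2_gt_zero_iff[of 1 x] by simp
      ultimately have "B \<le> B * (1 + r^2) / (1 + x^2)"
        by (metis divide_right_mono add_nonneg_nonneg zero_le_one zero_le_power2)
      then show ?thesis using B(2)[of x] by linarith
    qed (use H B in auto)
    then show ?thesis unfolding quad_decay_def using B(1) by (intro exI[of _ "B * (1 + r^2)"]) auto
  qed
  then show ?thesis
    unfolding C1_decay_def
    using C1_supp_cont[OF assms] C1_supp_cont_deriv[OF assms] C1_supp_DERIV[OF assms] C1_supp_zero[OF assms] C1_supp_deriv_zero[OF assms]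
      integral_compact_support(1)[of g r] integral_compact_support(1)[of "deriv g" r]
    by auto
qed

text \<open>At \<open>y = 0\<close> the value is 0, by the convention \<open>c / 0 = 0\<close>.\<close>

definition flip :: "real \<Rightarrow> (real \<Rightarrow> 'a::real_vector) \<Rightarrow> real \<Rightarrow> 'a" where
  "flip c f y = (c / y^2) *\<^sub>R f (c / y)"

text \<open>Change of variables for the involution y -> c / y of the punctured line, whose
  derivative has modulus \<open>c / y^2\<close>. It makes \<open>flip\<close> an isometry of
  L^1.\<close>

lemma flip_integral:
  fixes f :: "real \<Rightarrow> 'a::euclidean_space"
  assumes "0 < c" "integrable lborel f"
  shows "integrable lborel (flip c f)" "(\<integral>x. flip c f x \<partial>lborel) = (\<integral>x. f x \<partial>lborel)"
proof -
  note [measurable] = borel_measurable_integrable[OF assms(2)]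
  let ?S = "UNIV - {0::real}"
  have S: "?S \<in> sets lebesgue" by simp
  have im: "(\<lambda>y. c / y) ` ?S = ?S"
  proof (intro set_eqI iffI)
    fix x :: real assume "x \<in> ?S"
    then show "x \<in> (\<lambda>y. c / y) ` ?S" using assms(1) by (intro image_eqI[of _ _ "c / x"]) auto
  qed (use assms(1) in auto)
  have inj: "inj_on (\<lambda>y. c / y) ?S" using assms(1) by (auto simp: inj_on_def field_simps)
  have d: "((\<lambda>y. c / y) has_real_derivative - c / x^2) (at x within ?S)" if "x \<in> ?S" for x
    using that by (auto intro!: derivative_eq_intros simp: power2_eq_square)
  have AE0: "AE x in lborel. x \<noteq> (0::real)" by (rule AE_lborel_singleton)
  \<comment> \<open>The change of variables theorem speaks of gauge integrals and absolute
    integrability over the punctured line. This translates to \<open>lborel\<close>, the point 0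
    being null.\<close>
  have aeq: "g absolutely_integrable_on ?S \<longleftrightarrow> integrable lborel g"
    "g absolutely_integrable_on ?S \<Longrightarrow> integral ?S g = integral\<^sup>L lborel g"
    if [measurable]: "g \<in> borel_measurable borel" for g :: "real \<Rightarrow> 'a"
  proof -
    have m: "(\<lambda>x. indicator ?S x *\<^sub>R g x) \<in> borel_measurable lborel" by simp
    have AEg: "AE x in lborel. indicator ?S x *\<^sub>R g x = g x" using AE0 by eventually_elim simp
    show i: "g absolutely_integrable_on ?S \<longleftrightarrow> integrable lborel g"
      unfolding set_integrable_def integrable_completion[OF m]
      by (rule integrable_cong_AE[OF _ _ AEg]) simp_all
    assume a: "g absolutely_integrable_on ?S"
    have "integral ?S g = (LINT x:?S|lebesgue. g x)"
      by (rule set_lebesgue_integral_eq_integral(2)[OF a, symmetric])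
    also have "\<dots> = integral\<^sup>L lborel g"
      unfolding set_lebesgue_integral_def integral_completion[OF m]
      by (rule integral_cong_AE[OF _ _ AEg]) simp_all
    finally show "integral ?S g = integral\<^sup>L lborel g" .
  qed
  have tm: "flip c f \<in> borel_measurable borel" unfolding flip_def by measurable
  have te: "(\<lambda>x. \<bar>- c / x^2\<bar> *\<^sub>R f (c / x)) = flip c f"
    using assms(1) by (auto simp: flip_def fun_eq_iff abs_mult)
  have "flip c f absolutely_integrable_on ?S \<and> integral ?S (flip c f) = integral\<^sup>L lborel f"
    using has_absolute_integral_change_of_variables_real[OF S d inj, of f "integral\<^sup>L lborel f"]
      aeq[of f] assms(2) unfolding im te by simp
  then show "integrable lborel (flip c f)" "(\<integral>x. flip c f x \<partial>lborel) = (\<integral>x. f x \<partial>lborel)"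
    using aeq[OF tm] by auto
qed

text \<open>The left side is the derivative of the flip. On its support the inversion has derivative
  \<open>c / y^2 = (c / y)^2 / c <= r^2 / c\<close> in modulus. Writing the majorant as a flip makes
  its integral immediate; with \<open>r = b\<close> the factor \<open>r^2 / c\<close> becomes the
  contraction rate.\<close>

lemma flip_deriv_bound:
  assumes "C1_supp r g" "0 < r" "0 < c"
  shows "\<bar>- 2 * c / y^3 * g (c / y) - c^2 / y^4 * deriv g (c / y)\<bar>
     \<le> flip c (\<lambda>t. 2 * r / c * \<bar>g t\<bar> + r^2 / c * \<bar>deriv g t\<bar>) y"
proof (cases "y = 0 \<or> r \<le> \<bar>c / y\<bar>")
  case True
  then show ?thesis using C1_supp_zero[OF assms(1)] C1_supp_deriv_zero[OF assms(1)] by (auto simp: flip_def)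
next
  case False
  then have y: "y \<noteq> 0" "c / \<bar>y\<bar> \<le> r" using assms(3) by (auto simp: abs_div_pos)
  have "\<bar>- 2 * c / y^3 * g (c / y) - c^2 / y^4 * deriv g (c / y)\<bar>
     \<le> \<bar>2 * c / y^3 * g (c / y)\<bar> + \<bar>c^2 / y^4 * deriv g (c / y)\<bar>"
    using abs_triangle_ineq4[of "- 2 * c / y^3 * g (c / y)" "c^2 / y^4 * deriv g (c / y)"] by simp
  also have "\<bar>2 * c / y^3 * g (c / y)\<bar> = (c / y^2) * (2 * (c / \<bar>y\<bar>) / c * \<bar>g (c / y)\<bar>)"
    using assms(3) by (simp add: abs_mult power3_eq_cube power2_eq_square)
  also have "\<dots> \<le> (c / y^2) * (2 * r / c * \<bar>g (c / y)\<bar>)"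
    using assms(3) y by (intro mult_left_mono mult_right_mono divide_right_mono) auto
  also have "\<bar>c^2 / y^4 * deriv g (c / y)\<bar> = (c / y^2) * ((c / \<bar>y\<bar>)^2 / c * \<bar>deriv g (c / y)\<bar>)"
    using assms(3) by (simp add: abs_mult eval_nat_numeral)
  also have "\<dots> \<le> (c / y^2) * (r^2 / c * \<bar>deriv g (c / y)\<bar>)"
    using assms(3) y by (intro mult_left_mono mult_right_mono divide_right_mono power_mono) auto
  finally show ?thesis by (simp add: flip_def algebra_simps)
qed

text \<open>Compact support of \<open>g\<close> makes the flip vanish on |y| <= c / r, so the pole
  of \<open>c / y\<close> at 0 does no harm; boundedness of \<open>g\<close> and its derivative
  gives the decay at infinity.\<close>

lemma flip_C1_supp:
  assumes "C1_supp r g" "0 < r" "0 < c"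
  shows "C1_decay (flip c g)"
    "deriv (flip c g) y = - 2 * c / y^3 * g (c / y) - c^2 / y^4 * deriv g (c / y)"
    "\<bar>y\<bar> \<le> c / r \<Longrightarrow> flip c g y = 0"
proof -
  let ?G = "flip c g"
  let ?G' = "\<lambda>y. - 2 * c / y^3 * g (c / y) - c^2 / y^4 * deriv g (c / y)"
  define d where "d = c / r"
  have d: "0 < d" using assms by (simp add: d_def)
  have z: "g (c / y) = 0 \<and> deriv g (c / y) = 0" if "\<bar>y\<bar> \<le> d" "y \<noteq> 0" for y
  proof -
    have "r \<le> \<bar>c / y\<bar>" using that assms by (simp add: d_def abs_div_pos field_simps)
    then show ?thesis using C1_supp_zero[OF assms(1)] C1_supp_deriv_zero[OF assms(1)] by simp
  qed
  have zG: "?G y = 0" "?G' y = 0" if "\<bar>y\<bar> \<le> d" for y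
    using z[OF that] by (cases "y = 0"; simp add: flip_def)+
  then show "\<bar>y\<bar> \<le> c / r \<Longrightarrow> flip c g y = 0" by (simp add: d_def)
  have der: "(?G has_real_derivative ?G' y) (at y)" for y
  proof (cases "y = 0")
    case True
    have "(?G has_real_derivative 0) (at y)"
      by (rule has_field_derivative_transform_within_open[where S="{-d<..<d}" and f="\<lambda>x. 0"])
        (use True d zG in auto)
    then show ?thesis using True by simp
  next
    case False
    have 1: "((\<lambda>y. c / y) has_real_derivative - c / y^2) (at y)"
      using False by (auto intro!: derivative_eq_intros simp: power2_eq_square)
    have 2: "((\<lambda>y. c / y^2) has_real_derivative - 2 * c / y^3) (at y)"
      using False by (auto intro!: derivative_eq_intros simp: power2_eq_square power3_eq_cube field_simps)
    have 3: "((\<lambda>y. g (c / y)) has_real_derivative deriv g (c / y) * (- c / y^2)) (at y)"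
      by (rule DERIV_chain2[OF C1_supp_DERIV[OF assms(1)] 1])
    show ?thesis
      using DERIV_mult[OF 2 3] False
      by (simp add: flip_def[abs_def] power2_eq_square eval_nat_numeral field_simps)
  qed
  have cont: "continuous_on UNIV ?G'"
  proof (rule continuous_at_imp_continuous_on, rule ballI)
    fix y :: real
    show "isCont ?G' y"
    proof (cases "y = 0")
      case True
      have "\<forall>\<^sub>F x in nhds y. ?G' x = 0"
      proof (rule eventually_mono)
        show "\<forall>\<^sub>F x in nhds y. x \<in> {-d<..<d}"
          using eventually_nhds_in_open[of "{-d<..<d}" y] True d by auto
        show "?G' x = 0" if "x \<in> {-d<..<d}" for x
          using that by (intro zG) auto
      qed
      then show ?thesis by (subst isCont_cong[where g="\<lambda>x. 0"]) auto
    next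
      case False
      have "isCont g t" "isCont (deriv g) t" for t
        using C1_supp_cont[OF assms(1)] C1_supp_cont_deriv[OF assms(1)] by (auto simp: continuous_on_eq_continuous_at)
      note * = this
      have "isCont (\<lambda>y. c / y) y" using False by (intro continuous_intros)
      then have "isCont (\<lambda>y. g (c / y)) y" "isCont (\<lambda>y. deriv g (c / y)) y"
        by (auto intro: isCont_o2 *)
      then show ?thesis using False
        by (intro continuous_diff continuous_mult continuous_divide continuous_const
            continuous_power continuous_ident) auto
    qed
  qed
  obtain B where B: "0 \<le> B" "\<And>x. \<bar>g x\<bar> \<le> B"
    using compact_support_bounded[OF C1_supp_cont[OF assms(1)], of r] C1_supp_zero[OF assms(1)] by blast
  obtain B' where B': "0 \<le> B'" "\<And>x. \<bar>deriv g x\<bar> \<le> B'"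
    using compact_support_bounded[OF C1_supp_cont_deriv[OF assms(1)], of r] C1_supp_deriv_zero[OF assms(1)] by blast
  have dG: "quad_decay ?G"
  proof (rule quad_decay_outside[OF d, of "c * B"])
    fix y :: real
    show "\<bar>?G y\<bar> \<le> c * B / y^2"
      using B assms(3) by (auto simp: flip_def abs_mult intro!: divide_right_mono mult_left_mono)
  qed (use B assms(3) zG in auto)
  have dG': "quad_decay ?G'"
  proof (rule quad_decay_outside[OF d, of "2 * c * B / d + c^2 * B' / d^2"])
    fix y :: real assume y: "d \<le> \<bar>y\<bar>"
    have y2: "d^2 \<le> y^2" using y d by (metis abs_of_pos abs_le_square_iff)
    have "\<bar>?G' y\<bar> \<le> \<bar>2 * c / y^3 * g (c / y)\<bar> + \<bar>c^2 / y^4 * deriv g (c / y)\<bar>"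
    using abs_triangle_ineq4[of "- 2 * c / y^3 * g (c / y)" "c^2 / y^4 * deriv g (c / y)"] by simp
    also have "\<bar>2 * c / y^3 * g (c / y)\<bar> = (2 * c * \<bar>g (c / y)\<bar> / \<bar>y\<bar>) / y^2"
      using assms(3) by (simp add: abs_mult power3_eq_cube power2_eq_square)
    also have "\<dots> \<le> (2 * c * B / d) / y^2"
      using assms(3) B d y by (intro divide_right_mono frac_le mult_left_mono) auto
    also have "\<bar>c^2 / y^4 * deriv g (c / y)\<bar> = (c^2 * \<bar>deriv g (c / y)\<bar> / y^2) / y^2"
      by (simp add: abs_mult eval_nat_numeral)
    also have "\<dots> \<le> (c^2 * B' / d^2) / y^2"
      using B' d y2 by (intro divide_right_mono frac_le mult_left_mono) auto
    finally show "\<bar>?G' y\<bar> \<le> (2 * c * B / d + c^2 * B' / d^2) / y^2"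
      by (simp add: add_divide_distrib)
  qed (use B B' assms(3) d zG in auto)
  have iG: "integrable lborel ?G"
    by (rule flip_integral(1)[OF assms(3) C1_supp_integrable(1)[OF assms(1)]])
  have iG': "integrable lborel ?G'"
  proof (rule Bochner_Integration.integrable_bound)
    let ?F = "\<lambda>t. 2 * r / c * \<bar>g t\<bar> + r^2 / c * \<bar>deriv g t\<bar>"
    show "integrable lborel (flip c ?F)"
      by (intro flip_integral(1)[OF assms(3)] Bochner_Integration.integrable_add integrable_mult_right
          C1_supp_integrable[OF assms(1)])
    show "?G' \<in> borel_measurable lborel"
      using borel_measurable_continuous_onI[OF cont] by (simp only: measurable_lborel2)
    show "AE y in lborel. norm (?G' y) \<le> norm (flip c ?F y)"
      unfolding real_norm_def
      by (intro always_eventually allI order_trans[OF flip_deriv_bound[OF assms] abs_ge_self])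
  qed
  show "C1_decay ?G" "deriv ?G y = ?G' y"
    using C1_decayI[OF der cont dG dG' iG iG'] by auto
qed

section \<open>Smooth cutoff of a periodization\<close>

text \<open>\<open>b > 1\<close> makes neighbouring translates of [-b, b] by 2 overlap, which leaves
  room for a C^1 transition of width \<open>2 * b - 2\<close>; \<open>b < 2\<close> keeps the rise
  and the fall of the cutoff disjoint.\<close>

locale cutoff =
  fixes b :: real
  assumes b_gt: "1 < b" and b_lt: "b < 2"
begin

definition ramp :: "real \<Rightarrow> real" where "ramp x = sstep ((x - (- b)) / (2 * b - 2))"

text \<open>A step minus its translate by the period, so that the sum over all translates telescopes
  to 1.\<close>

definition cut :: "real \<Rightarrow> real" where "cut x = ramp x - ramp (x - 2)"

definition cut' :: "real \<Rightarrow> real" where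
  "cut' x = sstep' ((x - (- b)) / (2 * b - 2)) / (2 * b - 2) - sstep' ((x - (2 - b)) / (2 * b - 2)) / (2 * b - 2)"

lemma cut_alt: "cut x = ramp x - sstep ((x - (2 - b)) / (2 * b - 2))"
  by (simp add: cut_def ramp_def algebra_simps)

lemma ramp_mono: "x \<le> y \<Longrightarrow> ramp x \<le> ramp y"
  unfolding ramp_def by (intro sstep_mono divide_right_mono) (use b_gt in auto)

lemma ramp_left: "x \<le> - b \<Longrightarrow> ramp x = 0"
  unfolding ramp_def by (intro sstep_left divide_nonpos_nonneg) (use b_gt in auto)

lemma ramp_right: "b - 2 \<le> x \<Longrightarrow> ramp x = 1"
  unfolding ramp_def by (intro sstep_right) (use b_gt in \<open>simp add: field_simps\<close>)

lemma cut_C1_supp: "C1_supp b cut" and cut_deriv: "deriv cut = cut'"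
proof -
  have d: "(cut has_real_derivative cut' x) (at x)" for x
    unfolding cut_alt[abs_def] cut'_def ramp_def by (intro DERIV_diff sstep_affine_DERIV)
  have c: "continuous_on UNIV cut'"
    unfolding cut'_def[abs_def] by (intro continuous_on_diff sstep'_affine_cont)
  have z: "cut x = 0" if "b \<le> \<bar>x\<bar>" for x
    using that b_gt ramp_left[of x] ramp_left[of "x - 2"] ramp_right[of x] ramp_right[of "x - 2"]
    by (auto simp: cut_def abs_if split: if_splits)
  have z': "cut' x = 0" if "b \<le> \<bar>x\<bar>" for x
  proof (cases "x < 0")
    case True
    then have "(x - (- b)) / (2 * b - 2) \<le> 0" "(x - (2 - b)) / (2 * b - 2) \<le> 0"
      using b_gt b_lt that by (auto intro!: divide_nonpos_nonneg)
    then show ?thesis by (simp add: cut'_def sstep'_left)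
  next
    case False
    then have "1 \<le> (x - (- b)) / (2 * b - 2)" "1 \<le> (x - (2 - b)) / (2 * b - 2)"
      using b_gt b_lt that by (auto simp: field_simps)
    then show ?thesis by (simp add: cut'_def sstep'_right)
  qed
  show "C1_supp b cut" "deriv cut = cut'"
    using C1_suppI[OF d c z z'] by auto
qed

lemma cut_nonneg: "0 \<le> cut x"
  unfolding cut_def using ramp_mono[of "x - 2" x] by simp

lemma cut_zero: "b \<le> \<bar>x\<bar> \<Longrightarrow> cut x = 0" and cut'_zero: "b \<le> \<bar>x\<bar> \<Longrightarrow> cut' x = 0"
  using C1_supp_zero[OF cut_C1_supp] C1_supp_deriv_zero[OF cut_C1_supp] by (auto simp: cut_deriv)

lemma cut_sum: "(\<lambda>n. per_term cut n x) sums (1 - cut x)"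
proof -
  \<comment> \<open>The translates by \<open>-2N\<close> to \<open>2N\<close> telescope to the
    difference of ramps; \<open>per_term\<close> leaves out the central one, hence
    \<open>- cut x\<close>.\<close>
  have p: "(\<Sum>n<N. per_term cut n x) = ramp (x + 2 * real N) - ramp (x - 2 * real N - 2) - cut x" for N
  proof (induction N)
    case (Suc N)
    have "per_term cut N x = ramp (x + 2 * real (Suc N)) - ramp (x + 2 * real N)
        + (ramp (x - 2 * real N - 2) - ramp (x - 2 * real (Suc N) - 2))"
      by (simp add: per_term_def cut_def algebra_simps)
    then show ?case using Suc by simp
  qed (simp add: cut_def)
  obtain N0 where N0: "\<bar>x\<bar> + 2 \<le> real N0" using real_arch_simple by blast
  have "(\<Sum>n<N. per_term cut n x) = 1 - cut x" if "N0 \<le> N" for N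
  proof -
    have "\<bar>x\<bar> + 2 \<le> real N" using that N0 by linarith
    then have "ramp (x + 2 * real N) = 1" "ramp (x - 2 * real N - 2) = 0"
      using b_gt b_lt by (auto intro!: ramp_right ramp_left)
    then show ?thesis by (simp add: p)
  qed
  then have "\<forall>\<^sub>F N in sequentially. (\<Sum>n<N. per_term cut n x) = 1 - cut x"
    unfolding eventually_sequentially by blast
  then show ?thesis unfolding sums_def by (rule tendsto_eventually)
qed

text \<open>This is 1 on \<open>[-b, b]\<close>, so it can dominate the derivative of the cutoff and still be unfolded.\<close>

definition cut3 :: "real \<Rightarrow> real" where "cut3 x = cut (x - 2) + cut x + cut (x + 2)"

lemma cut3_sum: "(\<lambda>n. per_term cut3 n x) sums (3 - cut3 x)"
proof -
  have "per_term cut3 n x = per_term cut n (x - 2) + per_term cut n x + per_term cut n (x + 2)" for n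
    by (simp add: per_term_def cut3_def algebra_simps)
  then show ?thesis
    using sums_add[OF sums_add[OF cut_sum[of "x - 2"] cut_sum[of x]] cut_sum[of "x + 2"]]
    by (simp add: cut3_def algebra_simps)
qed

text \<open>\<open>sstep'\<close> is at most 2, so a ramp has slope at most
  \<open>2 / (2 * b - 2)\<close>, and \<open>cut'\<close> is a difference of two such
  slopes.\<close>

definition slope :: real where "slope = 4 / (2 * b - 2)"

lemma cut'_le: "\<bar>cut' x\<bar> \<le> slope * cut3 x"
proof (cases "b \<le> \<bar>x\<bar>")
  case True
  then show ?thesis using b_gt by (simp add: cut'_zero cut3_def cut_nonneg slope_def)
next
  case False
  \<comment> \<open>The three translates telescope; for |x| < b the first ramp is complete and the
    last has not begun.\<close>
  have "cut3 x = ramp (x + 2) - ramp (x - 4)"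
    by (simp add: cut3_def cut_def algebra_simps)
  also have "\<dots> = 1" using False b_lt b_gt ramp_right[of "x+2"] ramp_left[of "x - 4"] by simp
  finally have 1: "cut3 x = 1" .
  have "\<bar>sstep' t / (2 * b - 2)\<bar> \<le> 2 / (2 * b - 2)" for t
    using b_gt sstep'_nonneg[of t] sstep'_le[of t] by (auto intro!: divide_right_mono)
  from this[of "(x - (- b)) / (2 * b - 2)"] this[of "(x - (2 - b)) / (2 * b - 2)"]
  have "\<bar>cut' x\<bar> \<le> 2 / (2 * b - 2) + 2 / (2 * b - 2)" unfolding cut'_def by linarith
  also have "\<dots> = slope" by (simp add: slope_def flip: add_divide_distrib)
  finally show ?thesis using 1 by simp
qed

lemma cut_le_1: "cut x \<le> 1"
proof -
  have "0 \<le> ramp x" "ramp x \<le> 1" for x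
    using ramp_mono[of "min x (-b)" x] ramp_left[of "min x (-b)"]
      ramp_mono[of x "max x (b-2)"] ramp_right[of "max x (b - 2)"] by auto
  then show ?thesis unfolding cut_def by (metis diff_0_right diff_mono)
qed

text \<open>Replaces \<open>H\<close> by a compactly supported function with the same Fourier
  coefficients, see \<open>cut_periodize_fourier_coeff\<close>.\<close>

definition cut_periodize :: "(real \<Rightarrow> real) \<Rightarrow> real \<Rightarrow> real" where "cut_periodize H x = cut x * periodize H x"

text \<open>Up to normalization, a Fourier coefficient of the 2-periodization. Vanishing of the
  periodization is expressed through these numbers, which make sense for merely integrable
  functions.\<close>

definition fourier_coeff :: "int \<Rightarrow> (real \<Rightarrow> real) \<Rightarrow> complex" where
  "fourier_coeff m H = (\<integral>x. H x *\<^sub>R exp (\<i> * complex_of_real (pi * (of_int m * x))) \<partial>lborel)"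

lemma cut_periodize_C1_supp:
  assumes "C1_decay H"
  shows "C1_supp b (cut_periodize H)" "deriv (cut_periodize H) = (\<lambda>x. cut' x * periodize H x + cut x * periodize (deriv H) x)"
proof -
  note P = periodize_DERIV[of H "deriv H"]
  have H: "\<And>x. (H has_real_derivative deriv H x) (at x)" "continuous_on UNIV (deriv H)" "quad_decay H" "quad_decay (deriv H)"
    using assms by (auto simp: C1_decay_def)
  have d: "(cut_periodize H has_real_derivative cut' x * periodize H x + cut x * periodize (deriv H) x) (at x)" for x
    unfolding cut_periodize_def[abs_def]
    by (rule derivative_eq_intros C1_supp_DERIV[OF cut_C1_supp] P(1)[OF H] refl)+ (simp add: cut_deriv)
  have "continuous_on UNIV (periodize H)"
    using P(1)[OF H] by (meson DERIV_isCont continuous_at_imp_continuous_on)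
  then have c: "continuous_on UNIV (\<lambda>x. cut' x * periodize H x + cut x * periodize (deriv H) x)"
    using C1_supp_cont_deriv[OF cut_C1_supp] C1_supp_cont[OF cut_C1_supp] P(2)[OF H]
    by (intro continuous_intros) (auto simp: cut_deriv)
  show "C1_supp b (cut_periodize H)" "deriv (cut_periodize H) = (\<lambda>x. cut' x * periodize H x + cut x * periodize (deriv H) x)"
    using C1_suppI[OF d c, of b] by (auto simp: cut_periodize_def cut_zero cut'_zero)
qed

text \<open>Unfolding with the weights \<open>cut\<close> and \<open>cut3\<close>, whose
  periodizations are the constants 1 and 3.\<close>

lemma periodize_cut_integral:
  assumes "quad_decay H" "integrable lborel H"
  shows "integrable lborel (\<lambda>x. cut x * periodize H x)" "(\<integral>x. cut x * periodize H x \<partial>lborel) = (\<integral>x. H x \<partial>lborel)"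
    "integrable lborel (\<lambda>x. cut3 x * periodize H x)" "(\<integral>x. cut3 x * periodize H x \<partial>lborel) = 3 * (\<integral>x. H x \<partial>lborel)"
proof -
  have m: "H \<in> borel_measurable borel" using borel_measurable_integrable[OF assms(2)] by simp
  have cm [measurable]: "cut \<in> borel_measurable borel" by (rule C1_supp_integrable(6)[OF cut_C1_supp])
  have c3m: "cut3 \<in> borel_measurable borel" unfolding cut3_def[abs_def] by measurable
  have bd: "norm (cut x) \<le> 1" for x using cut_nonneg cut_le_1 by simp
  have bd3: "norm (cut3 x) \<le> 3" for x
    using bd[of x] bd[of "x - 2"] bd[of "x + 2"] by (simp add: cut3_def)
  have z3: "cut3 x = 0" if "b + 2 \<le> \<bar>x\<bar>" for x
    using that by (simp add: cut3_def cut_zero)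
  note u = periodize_unfold[OF assms(1) m assms(2) cm bd cut_zero cut_sum]
  note u3 = periodize_unfold[OF assms(1) m assms(2) c3m bd3 z3 cut3_sum]
  show "integrable lborel (\<lambda>x. cut x * periodize H x)" "(\<integral>x. cut x * periodize H x \<partial>lborel) = (\<integral>x. H x \<partial>lborel)"
    "integrable lborel (\<lambda>x. cut3 x * periodize H x)" "(\<integral>x. cut3 x * periodize H x \<partial>lborel) = 3 * (\<integral>x. H x \<partial>lborel)"
    using u u3 by (simp_all add: mult.commute)
qed

lemma cut_periodize_L1norm:
  assumes "C1_decay H"
  shows "L1norm (cut_periodize H) \<le> L1norm H"
proof -
  have H: "quad_decay (\<lambda>x. \<bar>H x\<bar>)" "integrable lborel (\<lambda>x. \<bar>H x\<bar>)" "quad_decay H"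
    using assms by (auto simp: C1_decay_def intro: quad_decay_abs)
  have "L1norm (cut_periodize H) \<le> (\<integral>x. cut x * periodize (\<lambda>x. \<bar>H x\<bar>) x \<partial>lborel)"
    unfolding L1norm_def
  proof (rule integral_mono)
    show "\<bar>cut_periodize H x\<bar> \<le> cut x * periodize (\<lambda>x. \<bar>H x\<bar>) x" for x
      using periodize_abs_le[OF H(3), of x] cut_nonneg[of x] by (simp add: cut_periodize_def abs_mult mult_left_mono)
  qed (use C1_supp_integrable(3)[OF cut_periodize_C1_supp(1)[OF assms]] periodize_cut_integral(1)[OF H(1,2)] in auto)
  also have "\<dots> = L1norm H" unfolding L1norm_def by (rule periodize_cut_integral(2)[OF H(1,2)])
  finally show ?thesis .
qed

text \<open>In the product rule the term with the derivative of \<open>H\<close> unfolds with weight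
  \<open>cut\<close>, hence with constant exactly 1. The term with \<open>cut'\<close> is dominated
  through \<open>cut3\<close>, which costs a factor 3 but involves only the weak norm.\<close>

lemma cut_periodize_tv:
  assumes "C1_decay H"
  shows "tv (cut_periodize H) \<le> (\<integral>x. \<bar>deriv H x\<bar> \<partial>lborel) + 3 * slope * L1norm H"
proof -
  have H: "quad_decay (\<lambda>x. \<bar>H x\<bar>)" "integrable lborel (\<lambda>x. \<bar>H x\<bar>)" "quad_decay H"
    and H': "quad_decay (\<lambda>x. \<bar>deriv H x\<bar>)" "integrable lborel (\<lambda>x. \<bar>deriv H x\<bar>)" "quad_decay (deriv H)"
    using assms by (auto simp: C1_decay_def intro: quad_decay_abs)
  have "tv (cut_periodize H) \<le> (\<integral>x. cut x * periodize (\<lambda>x. \<bar>deriv H x\<bar>) x + slope * (cut3 x * periodize (\<lambda>x. \<bar>H x\<bar>) x) \<partial>lborel)"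
    unfolding tv_def
  proof (rule integral_mono)
    fix x
    have "\<bar>deriv (cut_periodize H) x\<bar> \<le> \<bar>cut' x\<bar> * \<bar>periodize H x\<bar> + cut x * \<bar>periodize (deriv H) x\<bar>"
      unfolding cut_periodize_C1_supp(2)[OF assms] using cut_nonneg[of x] by (metis abs_mult abs_of_nonneg abs_triangle_ineq)
    also have "\<bar>cut' x\<bar> * \<bar>periodize H x\<bar> \<le> (slope * cut3 x) * periodize (\<lambda>x. \<bar>H x\<bar>) x"
      using periodize_abs_le[OF H(3), of x] cut'_le[of x] by (intro mult_mono) (auto intro: order_trans)
    also have "cut x * \<bar>periodize (deriv H) x\<bar> \<le> cut x * periodize (\<lambda>x. \<bar>deriv H x\<bar>) x"
      using periodize_abs_le[OF H'(3), of x] cut_nonneg[of x] by (intro mult_left_mono)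
    finally show "\<bar>deriv (cut_periodize H) x\<bar> \<le> cut x * periodize (\<lambda>x. \<bar>deriv H x\<bar>) x + slope * (cut3 x * periodize (\<lambda>x. \<bar>H x\<bar>) x)"
      by (simp add: mult.assoc)
  qed (use C1_supp_integrable(2)[OF cut_periodize_C1_supp(1)[OF assms]] periodize_cut_integral(1)[OF H'(1,2)] periodize_cut_integral(3)[OF H(1,2)] in auto)
  also have "\<dots> = (\<integral>x. \<bar>deriv H x\<bar> \<partial>lborel) + slope * (3 * L1norm H)"
    using periodize_cut_integral[OF H'(1,2)] periodize_cut_integral[OF H(1,2)] by (simp add: L1norm_def)
  finally show ?thesis by simp
qed

text \<open>The character is 2-periodic, so \<open>cut\<close> times the character has the character
  itself as periodization, and unfolding removes the cutoff.\<close>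

lemma cut_periodize_fourier_coeff:
  assumes "C1_decay H"
  shows "fourier_coeff m (cut_periodize H) = fourier_coeff m H"
proof -
  have H: "quad_decay H" "integrable lborel H" using assms by (auto simp: C1_decay_def)
  have m: "H \<in> borel_measurable borel" using borel_measurable_integrable[OF H(2)] by simp
  have [measurable]: "cut \<in> borel_measurable borel" by (rule C1_supp_integrable(6)[OF cut_C1_supp])
  define e where "e x = exp (\<i> * complex_of_real (pi * (of_int m * x)))" for x :: real
  have e1: "norm (e x) = 1" for x unfolding e_def by (rule norm_exp_i_times)
  have per: "e (x + 2 * of_int k) = e x" for x and k :: int
  proof -
    have "e (x + 2 * of_int k) = e x * exp (complex_of_real (2 * of_int (m * k) * pi) * \<i>)"
      unfolding e_def exp_add[symmetric] by (simp add: algebra_simps)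
    also have "exp (complex_of_real (2 * of_int (m * k) * pi) * \<i>) = 1"
      by (metis exp_integer_2pi Ints_of_int mult.commute mult.left_commute of_real_of_int_eq)
    finally show ?thesis by simp
  qed
  have Pt: "per_term (\<lambda>x. cut x *\<^sub>R e x) n x = per_term cut n x *\<^sub>R e x" for n x
    using per[of x "int (Suc n)"] per[of x "- int (Suc n)"]
    by (simp add: per_term_def scaleR_add_left algebra_simps)
  have s: "(\<lambda>n. per_term (\<lambda>x. cut x *\<^sub>R e x) n x) sums (e x - cut x *\<^sub>R e x)" for x
    unfolding Pt using sums_scaleR_left[OF cut_sum, of x "e x"] by (simp add: scaleR_diff_left)
  have em: "(\<lambda>x. cut x *\<^sub>R e x) \<in> borel_measurable borel"
    unfolding e_def by measurable
  have "fourier_coeff m (cut_periodize H) = (\<integral>x. periodize H x *\<^sub>R (cut x *\<^sub>R e x) \<partial>lborel)"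
    unfolding fourier_coeff_def cut_periodize_def e_def by (simp add: mult.commute)
  also have "\<dots> = (\<integral>x. H x *\<^sub>R e x \<partial>lborel)"
    by (rule periodize_unfold(3)[OF H(1) m H(2) em, of 1 b]) (auto simp: e1 cut_nonneg cut_le_1 cut_zero s)
  finally show ?thesis by (simp add: fourier_coeff_def e_def)
qed

end

section \<open>Interpolation on a grid\<close>

lemma tv_sum_le:
  assumes "finite I" "\<And>i. i \<in> I \<Longrightarrow> C1_supp r (g i)"
  shows "tv (\<lambda>x. \<Sum>i\<in>I. a i * g i x) \<le> (\<Sum>i\<in>I. \<bar>a i\<bar> * tv (g i))"
  using assms
proof (induction I rule: finite_induct)
  case empty
  then show ?case by (simp add: tv_def)
next
  case (insert i I)
  have "tv (\<lambda>x. (\<Sum>i\<in>I. a i * g i x) + a i * g i x) \<le> tv (\<lambda>x. \<Sum>i\<in>I. a i * g i x) + \<bar>a i\<bar> * tv (g i)"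
    using insert by (intro tv_lincomb_le[where r=r] C1_supp_sum) auto
  then show ?case using insert by (simp add: add.commute)
qed

locale grid =
  fixes r :: real and n :: nat
  assumes r_pos: "0 < r" and n_pos: "0 < n"
begin

definition mesh :: real where "mesh = 2 * r / real n"

definition node :: "nat \<Rightarrow> real" where "node i = - r + real i * mesh"

definition increment :: "nat \<Rightarrow> (real \<Rightarrow> real) \<Rightarrow> real" where
  "increment i g = g (node (Suc i)) - g (node i)"

definition phi :: "nat \<Rightarrow> real \<Rightarrow> real" where
  "phi i x = sstep ((x - node i) / mesh)"

definition phi' :: "nat \<Rightarrow> real \<Rightarrow> real" where
  "phi' i x = sstep' ((x - node i) / mesh) / mesh"

text \<open>Subtracting the last step makes the functions compactly supported; it does not change
  \<open>interp g\<close> because the increments of \<open>g\<close> add up to 0.\<close>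

definition psi :: "nat \<Rightarrow> real \<Rightarrow> real" where
  "psi i x = phi i x + (- 1) * phi (n - 1) x"

text \<open>A C^1 substitute for piecewise linear interpolation. It uses \<open>g\<close> through
  \<open>n\<close> increments only, which is the source of the finite rank.\<close>

definition interp :: "(real \<Rightarrow> real) \<Rightarrow> real \<Rightarrow> real" where
  "interp g x = (\<Sum>i<n. increment i g * psi i x)"

lemma mesh_pos: "0 < mesh"
  using r_pos n_pos by (simp add: mesh_def)

lemma node_0: "node 0 = - r" and node_n: "node n = r" and node_Suc: "node (Suc i) = node i + mesh"
  using n_pos by (simp_all add: node_def mesh_def algebra_simps add_divide_distrib)

lemma node_mono: "i \<le> j \<Longrightarrow> node i \<le> node j"
  using mesh_pos by (simp add: node_def)

lemma phi_left: "x \<le> node i \<Longrightarrow> phi i x = 0" and phi'_left: "x \<le> node i \<Longrightarrow> phi' i x = 0"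
  and phi_right: "node (Suc i) \<le> x \<Longrightarrow> phi i x = 1" and phi'_right: "node (Suc i) \<le> x \<Longrightarrow> phi' i x = 0"
  using mesh_pos unfolding phi_def phi'_def
  by (simp_all add: sstep_left sstep'_left sstep_right sstep'_right divide_nonpos_nonneg node_Suc)

lemma phi_DERIV: "(phi i has_real_derivative phi' i x) (at x)"
  unfolding phi_def[abs_def] phi'_def by (rule sstep_affine_DERIV)

lemma phi'_cont: "continuous_on UNIV (phi' i)"
  unfolding phi'_def[abs_def] by (rule sstep'_affine_cont)

lemma phi'_nonneg: "0 \<le> phi' i x"
  unfolding phi'_def using sstep'_nonneg mesh_pos by simp

lemma phi'_integral:
  assumes "i < n"
  shows "integrable lborel (phi' i)" "(\<integral>x. \<bar>phi' i x\<bar> \<partial>lborel) = 1"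
proof -
  have le: "- r \<le> node i" "node (Suc i) \<le> r"
    using node_mono[of 0 i] node_mono[of "Suc i" n] assms by (auto simp: node_0 node_n)
  have z: "phi' i x = 0" if "r \<le> \<bar>x\<bar>" for x
    using that le phi'_left[of x i] phi'_right[of i x] by (cases "x < 0") auto
  have "(phi' i has_integral (phi i r - phi i (- r))) {- r..r}"
    using r_pos
    by (intro fundamental_theorem_of_calculus)
      (auto simp flip: has_real_derivative_iff_has_vector_derivative
        intro: has_field_derivative_at_within phi_DERIV)
  moreover have "phi i r = 1" "phi i (- r) = 0"
    using le by (auto intro: phi_left phi_right)
  ultimately have "integral {- r..r} (phi' i) = 1" by (simp add: integral_unique)
  then show "integrable lborel (phi' i)" "(\<integral>x. \<bar>phi' i x\<bar> \<partial>lborel) = 1"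
    using integral_compact_support[OF phi'_cont z] phi'_nonneg by auto
qed

lemma psi_C1_supp:
  assumes "i < n"
  shows "C1_supp r (psi i)" "tv (psi i) \<le> 2"
proof -
  have d: "(psi i has_real_derivative phi' i x + (- 1) * phi' (n - 1) x) (at x)" for x
    unfolding psi_def[abs_def] by (intro DERIV_add DERIV_cmult phi_DERIV)
  have c: "continuous_on UNIV (\<lambda>x. phi' i x + (- 1) * phi' (n - 1) x)"
    by (intro continuous_intros phi'_cont)
  have z: "psi i x = 0" "phi' i x + (- 1) * phi' (n - 1) x = 0" if "r \<le> \<bar>x\<bar>" for x
  proof -
    have le: "- r \<le> node i" "node (Suc i) \<le> r" "- r \<le> node (n - 1)" "node (Suc (n - 1)) \<le> r"
      using node_mono[of 0 i] node_mono[of "Suc i" n] node_mono[of 0 "n - 1"] assms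
      by (auto simp: node_0 node_n)
    have "x \<le> - r \<or> r \<le> x" using that by auto
    then show "psi i x = 0" "phi' i x + (- 1) * phi' (n - 1) x = 0"
      using le phi_left[of x i] phi_left[of x "n - 1"] phi'_left[of x i] phi'_left[of x "n - 1"]
       phi_right[of i x] phi_right[of "n - 1" x] phi'_right[of i x] phi'_right[of "n - 1" x]
      by (auto simp: psi_def)
  qed
  show C: "C1_supp r (psi i)" by (rule C1_suppI(1)[OF d c z])
  have "tv (psi i) \<le> (\<integral>x. \<bar>phi' i x\<bar> + \<bar>phi' (n - 1) x\<bar> \<partial>lborel)"
    unfolding tv_def
  proof (rule integral_mono)
    show "\<bar>deriv (psi i) x\<bar> \<le> \<bar>phi' i x\<bar> + \<bar>phi' (n - 1) x\<bar>" for x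
      using C1_suppI(2)[OF d c z] by simp
  qed (use C1_supp_integrable(2)[OF C] phi'_integral(1) assms n_pos in auto)
  also have "\<dots> = 2"
    using phi'_integral assms n_pos by (subst Bochner_Integration.integral_add) auto
  finally show "tv (psi i) \<le> 2" .
qed

lemma cell_sum:
  assumes "continuous_on UNIV H"
  shows "(\<Sum>i<k. integral {node i..node (Suc i)} H) = integral {- r..node k} (H :: real \<Rightarrow> real)"
proof (induction k)
  case (Suc k)
  have "integral {- r..node k} H + integral {node k..node (Suc k)} H = integral {- r..node (Suc k)} H"
    using node_mono[of 0 k] mesh_pos
    by (intro Henstock_Kurzweil_Integration.integral_combine)
      (auto simp: node_0 node_Suc intro!: integrable_continuous_real continuous_on_subset[OF assms])
  then show ?case using Suc by simp
qed (simp add: node_0)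

lemma increment_sum_le:
  assumes "C1_supp r g"
  shows "(\<Sum>i<n. \<bar>increment i g\<bar>) \<le> tv g"
proof -
  have "(\<Sum>i<n. \<bar>increment i g\<bar>) \<le> (\<Sum>i<n. integral {node i..node (Suc i)} (\<lambda>x. \<bar>deriv g x\<bar>))"
    unfolding increment_def
    by (intro sum_mono C1_supp_diff_le_integral[OF assms] node_mono) auto
  also have "\<dots> = tv g"
    using C1_supp_cont_deriv[OF assms] C1_supp_integrable(4)[OF assms]
    by (subst cell_sum) (auto simp: node_n intro!: continuous_intros)
  finally show ?thesis .
qed

lemma increment_le: "C1_supp r g \<Longrightarrow> \<bar>increment i g\<bar> \<le> 2 * tv g"
  unfolding increment_def using C1_supp_sup_le_tv[of r g "node i"] C1_supp_sup_le_tv[of r g "node (Suc i)"] by linarith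

lemma interp_C1_supp: "C1_supp r (interp g)"
  unfolding interp_def[abs_def] by (intro C1_supp_sum psi_C1_supp) auto

text \<open>The constant is 1 + 2, as the interpolant has at most twice the variation of
  \<open>g\<close>. It does not depend on \<open>n\<close>, so refining the grid costs nothing in
  the strong norm.\<close>

lemma interp_tv:
  assumes "C1_supp r g"
  shows "tv (\<lambda>x. g x + (- 1) * interp g x) \<le> 3 * tv g"
proof -
  have "tv (interp g) \<le> (\<Sum>i<n. \<bar>increment i g\<bar> * tv (psi i))"
    unfolding interp_def[abs_def] by (rule tv_sum_le[where r=r]) (auto intro: psi_C1_supp)
  also have "\<dots> \<le> (\<Sum>i<n. \<bar>increment i g\<bar> * 2)"
    by (intro sum_mono mult_left_mono psi_C1_supp(2)) auto
  also have "\<dots> \<le> 2 * tv g" using increment_sum_le[OF assms] by (simp flip: sum_distrib_right)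
  finally show ?thesis
    using tv_lincomb_le[OF assms interp_C1_supp[of g], of "- 1"] by simp
qed

text \<open>At node \<open>k\<close> the first \<open>k\<close> steps are complete and the others
  have not begun, so the increments telescope to \<open>g (node k)\<close>; the correction by the
  last step drops out because all increments add up to 0.\<close>

lemma interp_node:
  assumes "C1_supp r g" "k \<le> n"
  shows "interp g (node k) = g (node k)"
proof -
  have tele: "(\<Sum>i<j. increment i g) = g (node j)" for j
    using sum_lessThan_telescope[of "\<lambda>i. g (node i)" j] C1_supp_zero[OF assms(1), of "- r"] r_pos
    by (simp add: increment_def node_0)
  have "interp g (node k) = (\<Sum>i<n. increment i g * phi i (node k)) - (\<Sum>i<n. increment i g) * phi (n - 1) (node k)"
    by (simp add: interp_def psi_def sum_distrib_right algebra_simps sum_subtractf)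
  also have "(\<Sum>i<n. increment i g) = 0"
    using tele[of n] C1_supp_zero[OF assms(1), of r] r_pos by (simp add: node_n)
  also have "(\<Sum>i<n. increment i g * phi i (node k)) = (\<Sum>i<k. increment i g)"
  proof (rule sum.mono_neutral_cong_right)
    show "\<forall>i\<in>{..<n} - {..<k}. increment i g * phi i (node k) = 0"
      using phi_left node_mono by auto
    show "increment i g * phi i (node k) = increment i g" if "i \<in> {..<k}" for i
      using phi_right[of i "node k"] node_mono[of "Suc i" k] that by simp
  qed (use assms in auto)
  finally show ?thesis using tele[of k] by simp
qed

text \<open>A Poincare inequality cell by cell: being zero at the left end, the function is bounded
  on the cell by its variation there.\<close>

lemma L1norm_le_of_nodes:
  assumes g: "C1_supp r g" and z: "\<And>k. k \<le> n \<Longrightarrow> g (node k) = 0"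
  shows "L1norm g \<le> mesh * tv g"
proof -
  have c: "continuous_on UNIV (\<lambda>x. \<bar>g x\<bar>)" "continuous_on UNIV (\<lambda>x. \<bar>deriv g x\<bar>)"
    by (intro continuous_intros C1_supp_cont[OF g] C1_supp_cont_deriv[OF g])+
  have "L1norm g = (\<Sum>i<n. integral {node i..node (Suc i)} (\<lambda>x. \<bar>g x\<bar>))"
    using C1_supp_integrable(5)[OF g] by (simp add: cell_sum[OF c(1)] node_n)
  also have "\<dots> \<le> (\<Sum>i<n. mesh * integral {node i..node (Suc i)} (\<lambda>x. \<bar>deriv g x\<bar>))"
  proof (rule sum_mono)
    fix i assume i: "i \<in> {..<n}"
    let ?J = "integral {node i..node (Suc i)} (\<lambda>x. \<bar>deriv g x\<bar>)"
    have "\<bar>g x\<bar> \<le> ?J" if "x \<in> {node i..node (Suc i)}" for x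
      using C1_supp_diff_le_integral[OF g, of "node i" x "node i" "node (Suc i)"] that z[of i] i by simp
    then have "integral {node i..node (Suc i)} (\<lambda>x. \<bar>g x\<bar>) \<le> integral {node i..node (Suc i)} (\<lambda>x. ?J)"
      by (intro integral_le) (auto intro!: integrable_continuous_real continuous_on_subset[OF c(1)])
    then show "integral {node i..node (Suc i)} (\<lambda>x. \<bar>g x\<bar>) \<le> mesh * ?J"
      using mesh_pos by (simp add: node_Suc)
  qed
  also have "\<dots> = mesh * tv g"
    using C1_supp_integrable(4)[OF g] by (simp add: cell_sum[OF c(2)] node_n flip: sum_distrib_left)
  finally show ?thesis .
qed

text \<open>A fine grid makes the interpolation error small in the weak norm, which tames the lower
  order term of the Lasota-Yorke inequality.\<close>

lemma interp_L1norm: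
  assumes "C1_supp r g"
  shows "L1norm (\<lambda>x. g x + (- 1) * interp g x) \<le> 3 * mesh * tv g"
proof -
  have "L1norm (\<lambda>x. g x + (- 1) * interp g x) \<le> mesh * tv (\<lambda>x. g x + (- 1) * interp g x)"
    by (rule L1norm_le_of_nodes[OF C1_supp_lincomb(1)[OF assms interp_C1_supp]]) (simp add: interp_node[OF assms])
  also have "\<dots> \<le> mesh * (3 * tv g)"
    using interp_tv[OF assms] mesh_pos by (intro mult_left_mono) auto
  finally show ?thesis by simp
qed

end

section \<open>The transfer operator\<close>

text \<open>In the theorem \<open>c\<close> is \<open>\<alpha> * \<beta>\<close>. For nonzero t in
  [-b, b] the inversion t -> c / t has derivative at least \<open>c / b^2\<close> in modulus, so the
  condition makes it uniformly expanding.\<close>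

locale expanding = cutoff +
  fixes c :: real
  assumes b_c: "b^2 < c"
begin

lemma c_pos: "0 < c"
  using b_c zero_le_power2[of b] by linarith

definition transfer :: "(real \<Rightarrow> real) \<Rightarrow> real \<Rightarrow> real" where "transfer g = cut_periodize (flip c g)"

definition \<theta> :: real where "\<theta> = b^2 / c"

definition lower_order_const :: real where "lower_order_const = 2 * b / c + 3 * slope"

lemma \<theta>_bounds: "0 \<le> \<theta>" "\<theta> < 1"
  using b_c c_pos by (auto simp: \<theta>_def)

lemma lower_order_const_nonneg: "0 \<le> lower_order_const"
  using c_pos b_gt by (simp add: lower_order_const_def slope_def)

lemma flip_quad_decay: "C1_supp b g \<Longrightarrow> C1_decay (flip c g)"
  using flip_C1_supp(1) b_gt c_pos by simp

lemma transfer_C1_supp: "C1_supp b g \<Longrightarrow> C1_supp b (transfer g)"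
  unfolding transfer_def by (rule cut_periodize_C1_supp(1)[OF flip_quad_decay])

lemma flip_L1norm:
  assumes "C1_supp b g"
  shows "L1norm (flip c g) = L1norm g"
proof -
  have "(\<lambda>x. \<bar>flip c g x\<bar>) = flip c (\<lambda>x. \<bar>g x\<bar>)"
    using c_pos by (auto simp: flip_def abs_mult fun_eq_iff)
  then show ?thesis
    unfolding L1norm_def using flip_integral(2)[OF c_pos C1_supp_integrable(3)[OF assms]] by simp
qed

lemma transfer_L1norm: "C1_supp b g \<Longrightarrow> L1norm (transfer g) \<le> L1norm g"
  unfolding transfer_def using cut_periodize_L1norm[OF flip_quad_decay] flip_L1norm by fastforce

text \<open>The Lasota-Yorke inequality. The derivative of the flip is bounded by a flip, which is
  integrated by isometry, and \<open>cut_periodize_tv\<close> does the rest;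
  \<open>lower_order_const\<close> collects the weak-norm contributions of both stages.\<close>

lemma transfer_tv:
  assumes "C1_supp b g"
  shows "tv (transfer g) \<le> \<theta> * tv g + lower_order_const * L1norm g"
proof -
  let ?F = "\<lambda>t. 2 * b / c * \<bar>g t\<bar> + b^2 / c * \<bar>deriv g t\<bar>"
  have b0: "0 < b" using b_gt by simp
  have i: "integrable lborel ?F"
    by (intro Bochner_Integration.integrable_add integrable_mult_right C1_supp_integrable[OF assms])
  have "(\<integral>x. \<bar>deriv (flip c g) x\<bar> \<partial>lborel) \<le> (\<integral>x. flip c ?F x \<partial>lborel)"
  proof (rule integral_mono)
    show "\<bar>deriv (flip c g) x\<bar> \<le> flip c ?F x" for x
      unfolding flip_C1_supp(2)[OF assms b0 c_pos] by (rule flip_deriv_bound[OF assms b0 c_pos])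
  qed (use flip_quad_decay[OF assms] flip_integral(1)[OF c_pos i] in \<open>auto simp: C1_decay_def\<close>)
  also have "\<dots> = (\<integral>x. ?F x \<partial>lborel)" by (rule flip_integral(2)[OF c_pos i])
  also have "\<dots> = 2 * b / c * L1norm g + \<theta> * tv g"
    unfolding L1norm_def tv_def \<theta>_def
    by (subst Bochner_Integration.integral_add) (auto intro!: C1_supp_integrable[OF assms])
  finally show ?thesis
    unfolding transfer_def lower_order_const_def using cut_periodize_tv[OF flip_quad_decay[OF assms]] flip_L1norm[OF assms] by (simp add: algebra_simps)
qed

lemma transfer_lincomb:
  assumes "C1_supp b g" "C1_supp b h"
  shows "transfer (\<lambda>x. g x + a * h x) = (\<lambda>x. transfer g x + a * transfer h x)"
proof -
  have *: "flip c (\<lambda>x. g x + a * h x) = (\<lambda>x. flip c g x + a * flip c h x)"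
    by (simp add: flip_def fun_eq_iff algebra_simps add_divide_distrib)
  have "periodize (\<lambda>x. flip c g x + a * flip c h x) x = periodize (flip c g) x + a * periodize (flip c h) x" for x
    using flip_quad_decay[OF assms(1)] flip_quad_decay[OF assms(2)] by (intro periodize_lincomb) (auto simp: C1_decay_def)
  then show ?thesis
    unfolding transfer_def cut_periodize_def * by (simp add: algebra_simps)
qed

lemma transfer_pow_C1_supp: "C1_supp b g \<Longrightarrow> C1_supp b ((transfer ^^ i) g)"
  by (induction i) (auto intro: transfer_C1_supp)

lemma transfer_pow_L1norm: "C1_supp b g \<Longrightarrow> L1norm ((transfer ^^ i) g) \<le> L1norm g"
  by (induction i) (auto intro: order_trans[OF transfer_L1norm] transfer_pow_C1_supp)

text \<open>Each step shrinks the strong norm by \<theta> and adds a lower order term. The weak norm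
  never grows and \<theta> <= 1, so \<open>i\<close> steps add at most \<open>i\<close> such
  terms.\<close>

lemma transfer_pow_tv:
  assumes "C1_supp b g"
  shows "tv ((transfer ^^ i) g) \<le> \<theta> ^ i * tv g + real i * lower_order_const * L1norm g"
proof (induction i)
  case (Suc i)
  have "tv ((transfer ^^ Suc i) g) \<le> \<theta> * tv ((transfer ^^ i) g) + lower_order_const * L1norm ((transfer ^^ i) g)"
    using transfer_tv[OF transfer_pow_C1_supp[OF assms]] by simp
  also have "\<dots> \<le> \<theta> * (\<theta> ^ i * tv g + real i * lower_order_const * L1norm g) + lower_order_const * L1norm g"
    by (intro add_mono mult_left_mono Suc transfer_pow_L1norm[OF assms] \<theta>_bounds lower_order_const_nonneg)
  also have "\<dots> \<le> \<theta> * (\<theta> ^ i * tv g) + real i * lower_order_const * L1norm g + lower_order_const * L1norm g"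
  proof -
    have "\<theta> * (real i * lower_order_const * L1norm g) \<le> 1 * (real i * lower_order_const * L1norm g)"
      using \<theta>_bounds lower_order_const_nonneg L1norm_nonneg[of g] by (intro mult_right_mono) auto
    then show ?thesis by (simp add: distrib_left)
  qed
  finally show ?case by (simp add: algebra_simps)
qed simp

lemma transfer_pow_lincomb:
  assumes "C1_supp b g" "C1_supp b h"
  shows "(transfer ^^ i) (\<lambda>x. g x + a * h x) = (\<lambda>x. (transfer ^^ i) g x + a * (transfer ^^ i) h x)"
  by (induction i) (simp_all add: transfer_lincomb transfer_pow_C1_supp assms)

lemma transfer_pow_0: "(transfer ^^ i) (\<lambda>x. 0) = (\<lambda>x. 0)"
  using transfer_pow_lincomb[OF C1_supp_0 C1_supp_0, of i "- 1"] by simp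

lemma transfer_pow_sum:
  assumes "finite I" "\<And>i. i \<in> I \<Longrightarrow> C1_supp b (g i)"
  shows "(transfer ^^ m) (\<lambda>x. \<Sum>i\<in>I. a i * g i x) = (\<lambda>x. \<Sum>i\<in>I. a i * (transfer ^^ m) (g i) x)"
  using assms
proof (induction I rule: finite_induct)
  case empty
  then show ?case by (simp add: transfer_pow_0)
next
  case (insert i I)
  then show ?case
    using transfer_pow_lincomb[of "\<lambda>x. \<Sum>i\<in>I. a i * g i x" "g i" m "a i"] C1_supp_sum[of I b g a]
    by (simp add: add.commute)
qed

section \<open>The Fourier conditions of the two axes\<close>

definition fourier_coeff' :: "int \<Rightarrow> (real \<Rightarrow> real) \<Rightarrow> complex" where
  "fourier_coeff' m g = (\<integral>x. g x *\<^sub>R exp (\<i> * complex_of_real (pi * (of_int m * (c / x)))) \<partial>lborel)"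

lemma integrable_weight:
  fixes g :: "real \<Rightarrow> real"
  assumes "integrable lborel g" "e \<in> borel_measurable borel" "\<And>x. norm (e x :: complex) \<le> 1"
  shows "integrable lborel (\<lambda>x. g x *\<^sub>R e x)"
proof (rule Bochner_Integration.integrable_bound[OF assms(1)])
  show "(\<lambda>x. g x *\<^sub>R e x) \<in> borel_measurable lborel"
    using assms(2) borel_measurable_integrable[OF assms(1)] by simp
  show "AE x in lborel. norm (g x *\<^sub>R e x) \<le> norm (g x)"
    using assms(3) by (auto intro!: always_eventually mult_left_le)
qed

lemma character:
  "(\<lambda>x. exp (\<i> * complex_of_real (pi * (of_int m * x)))) \<in> borel_measurable borel"
  "norm (exp (\<i> * complex_of_real (pi * (of_int m * x)))) \<le> 1"
  "(\<lambda>x. exp (\<i> * complex_of_real (pi * (of_int m * (c / x))))) \<in> borel_measurable borel"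
  "norm (exp (\<i> * complex_of_real (pi * (of_int m * (c / x))))) \<le> 1"
  unfolding norm_exp_i_times by (measurable; simp)+

text \<open>The substitution y -> c / y exchanges the phases of the two axes. At
  \<open>y = 0\<close> both integrands vanish by the convention \<open>c / 0 = 0\<close>.\<close>

lemma fourier_coeff_flip:
  assumes "integrable lborel g"
  shows "fourier_coeff m (flip c g) = fourier_coeff' m g"
proof -
  let ?f = "\<lambda>x. g x *\<^sub>R exp (\<i> * complex_of_real (pi * (of_int m * (c / x))))"
  have "fourier_coeff m (flip c g) = (\<integral>x. flip c ?f x \<partial>lborel)"
    unfolding fourier_coeff_def flip_def using c_pos by (intro Bochner_Integration.integral_cong) auto
  also have "\<dots> = fourier_coeff' m g"
    unfolding fourier_coeff'_def by (intro flip_integral(2) c_pos integrable_weight assms character)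
  finally show ?thesis .
qed

text \<open>The link between the operator and the problem: on Fourier coefficients,
  \<open>A - transfer A\<close> becomes
  \<open>fourier_coeff m A - fourier_coeff' m A\<close>.\<close>

lemma fourier_coeff_transfer: "C1_supp b g \<Longrightarrow> fourier_coeff m (transfer g) = fourier_coeff' m g"
  unfolding transfer_def by (simp add: cut_periodize_fourier_coeff flip_quad_decay fourier_coeff_flip C1_supp_integrable)

lemma fourier_coeff_le: "C1_supp b g \<Longrightarrow> norm (fourier_coeff m g) \<le> 2 * b * tv g"
proof -
  assume g: "C1_supp b g"
  have "norm (fourier_coeff m g) \<le> (\<integral>x. norm (g x *\<^sub>R exp (\<i> * complex_of_real (pi * (of_int m * x)))) \<partial>lborel)"
    unfolding fourier_coeff_def by (rule integral_norm_bound)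
  also have "\<dots> = L1norm g" unfolding L1norm_def norm_scaleR norm_exp_i_times by simp
  also have "\<dots> \<le> 2 * b * tv g" using C1_supp_L1norm_le_tv[OF g] b_gt by simp
  finally show ?thesis .
qed

lemma fourier_coeff_sum:
  assumes "finite I" "\<And>i. i \<in> I \<Longrightarrow> integrable lborel (g i)"
  shows "fourier_coeff m (\<lambda>x. \<Sum>i\<in>I. a i * g i x) = (\<Sum>i\<in>I. a i *\<^sub>R fourier_coeff m (g i))"
    "fourier_coeff' m (\<lambda>x. \<Sum>i\<in>I. a i * g i x) = (\<Sum>i\<in>I. a i *\<^sub>R fourier_coeff' m (g i))"
proof -
  have *: "(\<integral>x. (\<Sum>i\<in>I. a i * g i x) *\<^sub>R e x \<partial>lborel) = (\<Sum>i\<in>I. a i *\<^sub>R (\<integral>x. g i x *\<^sub>R e x \<partial>lborel))"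
    if e: "e \<in> borel_measurable borel" "\<And>x. norm (e x :: complex) \<le> 1" for e
  proof -
    have "(\<integral>x. (\<Sum>i\<in>I. a i * g i x) *\<^sub>R e x \<partial>lborel) = (\<integral>x. (\<Sum>i\<in>I. a i *\<^sub>R (g i x *\<^sub>R e x)) \<partial>lborel)"
      by (simp add: scaleR_sum_left)
    also have "\<dots> = (\<Sum>i\<in>I. \<integral>x. a i *\<^sub>R (g i x *\<^sub>R e x) \<partial>lborel)"
      by (intro Bochner_Integration.integral_sum integrable_scaleR_right integrable_weight assms e)
    finally show ?thesis by (simp only: integral_scaleR_right)
  qed
  show "fourier_coeff m (\<lambda>x. \<Sum>i\<in>I. a i * g i x) = (\<Sum>i\<in>I. a i *\<^sub>R fourier_coeff m (g i))"
    "fourier_coeff' m (\<lambda>x. \<Sum>i\<in>I. a i * g i x) = (\<Sum>i\<in>I. a i *\<^sub>R fourier_coeff' m (g i))"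
    unfolding fourier_coeff_def fourier_coeff'_def by (rule *[OF character(1,2)], rule *[OF character(3,4)])
qed

lemma fourier_coeff_add:
  assumes "integrable lborel g" "integrable lborel h"
  shows "fourier_coeff m (\<lambda>x. g x + h x) = fourier_coeff m g + fourier_coeff m h"
  unfolding fourier_coeff_def scaleR_add_left
  by (intro Bochner_Integration.integral_add integrable_weight character assms)

end

section \<open>Neumann series\<close>

context expanding
begin

lemma contraction_exists:
  obtains m n where "0 < n"
    "\<And>g. C1_supp b g \<Longrightarrow> tv ((transfer ^^ m) (\<lambda>x. g x + (- 1) * grid.interp b n g x)) \<le> tv g / 2"
proof -
  \<comment> \<open>\<open>interp_tv\<close> costs a factor 3, and 3/12 is half of the desired 1/2.
    The power is fixed first because the lower order term grows with it; the grid is adapted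
    afterwards.\<close>
  obtain m where m: "\<theta> ^ m < 1 / 12"
    using real_arch_pow_inv[of "1/12" \<theta>] \<theta>_bounds by auto
  \<comment> \<open>With mesh \<open>2 * b / n'\<close> this bounds the lower order coefficient
    times \<open>3 * mesh\<close> by the remaining 1/4.\<close>
  obtain n where n: "12 * (real m * lower_order_const * (2 * b)) < real n" using reals_Archimedean2 by blast
  define n' where "n' = Suc n"
  interpret grid b n' by unfold_locales (use b_gt in \<open>auto simp: n'_def\<close>)
  have "12 * (real m * lower_order_const * (2 * b)) \<le> real n'" using n by (simp add: n'_def)
  then have h: "real m * lower_order_const * (3 * mesh) \<le> 1 / 4"
    using n_pos by (simp add: mesh_def field_simps)
  show ?thesis
  proof (rule that[of n' m])
    fix g assume g: "C1_supp b g"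
    let ?r = "\<lambda>x. g x + (- 1) * interp g x"
    have "tv ((transfer ^^ m) ?r) \<le> \<theta> ^ m * tv ?r + real m * lower_order_const * L1norm ?r"
      by (rule transfer_pow_tv[OF C1_supp_lincomb(1)[OF g interp_C1_supp]])
    also have "\<dots> \<le> 1 / 12 * (3 * tv g) + real m * lower_order_const * (3 * mesh * tv g)"
      using m lower_order_const_nonneg by (intro add_mono mult_mono mult_left_mono interp_tv[OF g] interp_L1norm[OF g])
        (auto intro: tv_nonneg)
    also have "\<dots> = 1 / 4 * tv g + real m * lower_order_const * (3 * mesh) * tv g" by simp
    also have "\<dots> \<le> 1 / 4 * tv g + 1 / 4 * tv g"
      by (intro add_mono mult_right_mono h) (auto intro: tv_nonneg)
    finally show "tv ((transfer ^^ m) ?r) \<le> tv g / 2" by simp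
  qed (simp add: n'_def)
qed

text \<open>Geometric decay in the supremum norm on a common support gives summable L^1 norms, so
  sum and integral may be exchanged.\<close>

lemma fourier_coeff_suminf:
  fixes a :: "nat \<Rightarrow> real \<Rightarrow> real"
  assumes a: "\<And>j. C1_supp b (a j)" and K: "\<And>j x. \<bar>a j x\<bar> \<le> K * (1/2) ^ j"
  shows "integrable lborel (\<lambda>x. \<Sum>j. a j x)"
    "(\<lambda>j. fourier_coeff m (a j)) sums fourier_coeff m (\<lambda>x. \<Sum>j. a j x)"
    "(\<lambda>j. fourier_coeff' m (a j)) sums fourier_coeff' m (\<lambda>x. \<Sum>j. a j x)"
proof -
  have geo: "summable (\<lambda>j. C * (1/2) ^ j)" for C :: real
    by (intro summable_mult summable_geometric) simp
  have s: "summable (\<lambda>j. \<bar>a j x\<bar>)" for x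
    by (rule summable_comparison_test'[OF geo[of K], of 0]) (use K in auto)
  have L: "L1norm (a j) \<le> (2 * b * K) * (1/2) ^ j" for j
  proof -
    have "L1norm (a j) = integral {-b..b} (\<lambda>x. \<bar>a j x\<bar>)" by (rule C1_supp_integrable(5)[OF a])
    also have "\<dots> \<le> integral {-b..b} (\<lambda>x. K * (1/2) ^ j)"
      by (intro integral_le K)
        (auto intro!: integrable_continuous_real continuous_intros continuous_on_subset[OF C1_supp_cont[OF a]])
    also have "\<dots> = (2 * b * K) * (1/2) ^ j" using b_gt by simp
    finally show ?thesis .
  qed
  have sL: "summable (\<lambda>j. L1norm (a j))"
    by (rule summable_comparison_test'[OF geo[of "2 * b * K"], of 0]) (use L L1norm_nonneg in auto)
  note i = C1_supp_integrable(1)[OF a]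
  show "integrable lborel (\<lambda>x. \<Sum>j. a j x)"
    by (rule integrable_suminf[OF i]) (use s sL in \<open>auto simp: L1norm_def\<close>)
  have *: "(\<lambda>j. \<integral>x. a j x *\<^sub>R e x \<partial>lborel) sums (\<integral>x. (\<Sum>j. a j x) *\<^sub>R e x \<partial>lborel)"
    if e: "e \<in> borel_measurable borel" "\<And>x. norm (e x :: complex) = 1" for e
  proof -
    have ie: "integrable lborel (\<lambda>x. a j x *\<^sub>R e x)" for j
      by (rule integrable_weight[OF i e(1)]) (simp add: e)
    have A: "AE x in lborel. summable (\<lambda>j. norm (a j x *\<^sub>R e x))"
      using s by (simp add: e)
    have B: "summable (\<lambda>j. \<integral>x. norm (a j x *\<^sub>R e x) \<partial>lborel)"
      using sL by (simp add: e L1norm_def)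
    have "(\<Sum>j. a j x *\<^sub>R e x) = (\<Sum>j. a j x) *\<^sub>R e x" for x
      by (rule suminf_scaleR_left[OF summable_rabs_cancel[OF s], symmetric])
    then show ?thesis
      using sums_integral[OF ie A B] by simp
  qed
  show "(\<lambda>j. fourier_coeff m (a j)) sums fourier_coeff m (\<lambda>x. \<Sum>j. a j x)"
    "(\<lambda>j. fourier_coeff' m (a j)) sums fourier_coeff' m (\<lambda>x. \<Sum>j. a j x)"
    unfolding fourier_coeff_def fourier_coeff'_def by (intro * character norm_exp_i_times)+
qed

text \<open>Write Q for \<open>transfer\<close>, P for \<open>interp\<close> and R = Q^p (1 - P),
  which halves \<open>tv\<close>. Applying 1 - Q to the sum of Q^i over i < p gives 1 - Q^p = 1 - R
  - Q^p P. Summed over the orbit \<open>g j\<close> = R^j k, this leaves \<open>k\<close> up to the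
  range of Q^p P, spanned by the \<open>n\<close> functions Q^p (\<open>psi i\<close>). These
  determine \<open>V\<close> before \<open>h\<close> is given; only \<open>L\<close> depends on
  \<open>h\<close>.\<close>

lemma solve_up_to_finite_rank:
  obtains n :: nat and V :: "nat \<Rightarrow> int \<Rightarrow> complex" where
    "\<forall>h. C1_decay h \<longrightarrow> (\<exists>A L. integrable lborel A \<and> (\<forall>x. b \<le> \<bar>x\<bar> \<longrightarrow> A x = 0) \<and>
       (\<forall>m. fourier_coeff m A - fourier_coeff' m A + fourier_coeff m h = (\<Sum>i<n. L i *\<^sub>R V i m)))"
proof -
  obtain p n where n: "0 < n" and contr:
    "\<And>g. C1_supp b g \<Longrightarrow> tv ((transfer ^^ p) (\<lambda>x. g x + (- 1) * grid.interp b n g x)) \<le> tv g / 2"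
    by (rule contraction_exists) (rule that)
  interpret grid b n by unfold_locales (use b_gt n in auto)
  define R where "R g = (transfer ^^ p) (\<lambda>x. g x + (- 1) * interp g x)" for g
  have R_C1_supp: "C1_supp b (R g)" if "C1_supp b g" for g
    unfolding R_def by (intro transfer_pow_C1_supp C1_supp_lincomb(1) that interp_C1_supp)
  show ?thesis
  proof (rule that[of "\<lambda>i m. - fourier_coeff m ((transfer ^^ p) (psi i))" n], intro allI impI)
    fix h assume h: "C1_decay h"
    \<comment> \<open>The contribution of \<open>h\<close> is to be cancelled, hence the minus sign;
      the leading 0 fits \<open>C1_supp_lincomb\<close>.\<close>
    define k where "k = (\<lambda>x. 0 + (- 1) * cut_periodize h x)"
    have k: "C1_supp b k" unfolding k_def by (rule C1_supp_lincomb(1)[OF C1_supp_0 cut_periodize_C1_supp(1)[OF h]])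
    have fk: "fourier_coeff m k = - fourier_coeff m h" for m
      using cut_periodize_fourier_coeff[OF h, of m] by (simp add: k_def fourier_coeff_def)
    define g where "g j = (R ^^ j) k" for j
    have g: "C1_supp b (g j)" for j
      unfolding g_def by (induction j) (auto intro: R_C1_supp k)
    have g_tv: "tv (g j) \<le> tv k * (1/2) ^ j" for j
    proof (induction j)
      case (Suc j)
      have "tv (g (Suc j)) \<le> tv (g j) / 2"
        using contr[OF g[of j]] by (simp add: g_def R_def)
      then show ?case using Suc by simp
    qed (simp add: g_def)
    \<comment> \<open>The block of the Neumann series on which 1 - Q telescopes to
      \<open>g j\<close> minus Q^p (\<open>g j\<close>). The factor 1 fits the lemmas on weighted
      sums.\<close>
    define a where "a j x = (\<Sum>i<p. 1 * (transfer ^^ i) (g j) x)" for j x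
    have a: "C1_supp b (a j)" for j
      unfolding a_def[abs_def] by (intro C1_supp_sum transfer_pow_C1_supp g) auto
    \<comment> \<open>Sums the bounds of \<open>transfer_pow_tv\<close> over i < p, with \<theta>^i
      <= 1 and the weak norm estimated by \<open>2 * b\<close> times \<open>tv\<close>.\<close>
    define K where "K = (\<Sum>i<p. 1 + real i * lower_order_const * (2 * b)) * tv k"
    have aK: "\<bar>a j x\<bar> \<le> K * (1/2) ^ j" for j x
    proof -
      have "\<bar>(transfer ^^ i) (g j) x\<bar> \<le> (1 + real i * lower_order_const * (2 * b)) * (tv k * (1/2)^j)" for i
      proof -
        have "\<bar>(transfer ^^ i) (g j) x\<bar> \<le> tv ((transfer ^^ i) (g j))" by (rule C1_supp_sup_le_tv[OF transfer_pow_C1_supp[OF g]])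
        also have "\<dots> \<le> \<theta> ^ i * tv (g j) + real i * lower_order_const * L1norm (g j)" by (rule transfer_pow_tv[OF g])
        also have "\<dots> \<le> 1 * tv (g j) + real i * lower_order_const * (2 * b * tv (g j))"
          using \<theta>_bounds lower_order_const_nonneg b_gt
          by (intro add_mono mult_right_mono mult_left_mono C1_supp_L1norm_le_tv[OF g] power_le_one) (auto intro: tv_nonneg)
        also have "\<dots> = (1 + real i * lower_order_const * (2 * b)) * tv (g j)" by (simp add: algebra_simps)
        also have "\<dots> \<le> (1 + real i * lower_order_const * (2 * b)) * (tv k * (1/2)^j)"
          using lower_order_const_nonneg b_gt by (intro mult_left_mono g_tv) auto
        finally show ?thesis .
      qed
      then have "(\<Sum>i<p. \<bar>(transfer ^^ i) (g j) x\<bar>) \<le> K * (1/2) ^ j"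
        unfolding K_def sum_distrib_right mult.assoc by (intro sum_mono) (simp add: mult.assoc)
      with sum_abs[of "\<lambda>i. (transfer ^^ i) (g j) x" "{..<p}"] show ?thesis
        unfolding a_def mult_1 by (rule order_trans)
    qed
    define A where "A x = (\<Sum>j. a j x)" for x
    define L where "L i = (\<Sum>j. increment i (g j))" for i
    have fin: "fourier_coeff m (a j) - fourier_coeff' m (a j) = fourier_coeff m (g j) - fourier_coeff m (g (Suc j))
        - (\<Sum>i<n. increment i (g j) *\<^sub>R fourier_coeff m ((transfer ^^ p) (psi i)))" for j m
    proof -
      have "fourier_coeff m (a j) - fourier_coeff' m (a j) = (\<Sum>i<p. fourier_coeff m ((transfer ^^ i) (g j)) - fourier_coeff m ((transfer ^^ Suc i) (g j)))"
        unfolding a_def fourier_coeff_sum[OF finite_lessThan C1_supp_integrable(1)[OF transfer_pow_C1_supp[OF g]]]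
        by (simp add: sum_subtractf fourier_coeff_transfer[OF transfer_pow_C1_supp[OF g]])
      also have "\<dots> = fourier_coeff m (g j) - fourier_coeff m ((transfer ^^ p) (g j))"
        by (induction p) auto
      also have "(transfer ^^ p) (g j) = (\<lambda>x. g (Suc j) x + (\<Sum>i<n. increment i (g j) * (transfer ^^ p) (psi i) x))"
      proof -
        have "g (Suc j) = (\<lambda>x. (transfer ^^ p) (g j) x + (- 1) * (transfer ^^ p) (interp (g j)) x)"
          using transfer_pow_lincomb[OF g interp_C1_supp, of p j "- 1" "g j"] by (simp add: g_def R_def)
        moreover have "(transfer ^^ p) (interp (g j)) = (\<lambda>x. \<Sum>i<n. increment i (g j) * (transfer ^^ p) (psi i) x)"
          unfolding interp_def[abs_def] by (rule transfer_pow_sum) (auto intro: psi_C1_supp)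
        ultimately show ?thesis by simp
      qed
      also have "fourier_coeff m \<dots> = fourier_coeff m (g (Suc j)) + fourier_coeff m (\<lambda>x. \<Sum>i<n. increment i (g j) * (transfer ^^ p) (psi i) x)"
        by (intro fourier_coeff_add C1_supp_integrable(1)[OF g] C1_supp_integrable(1)[OF C1_supp_sum[where r=b]]) (auto intro: transfer_pow_C1_supp psi_C1_supp)
      also have "fourier_coeff m (\<lambda>x. \<Sum>i<n. increment i (g j) * (transfer ^^ p) (psi i) x) =
          (\<Sum>i<n. increment i (g j) *\<^sub>R fourier_coeff m ((transfer ^^ p) (psi i)))"
        by (rule fourier_coeff_sum) (auto intro: C1_supp_integrable(1)[OF transfer_pow_C1_supp[OF psi_C1_supp(1)]])
      finally show ?thesis by (simp add: algebra_simps)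
    qed
    have sl: "summable (\<lambda>j. increment i (g j))" for i
    proof (rule summable_comparison_test'[of "\<lambda>j. 2 * tv k * (1/2) ^ j" 0])
      show "summable (\<lambda>j. 2 * tv k * (1/2) ^ j)" by (intro summable_mult summable_geometric) simp
      show "norm (increment i (g j)) \<le> 2 * tv k * (1/2) ^ j" for j
        using increment_le[OF g[of j], of i] g_tv[of j] by simp
    qed
    have "fourier_coeff m A - fourier_coeff' m A + fourier_coeff m h = (\<Sum>i<n. L i *\<^sub>R - fourier_coeff m ((transfer ^^ p) (psi i)))" for m
    proof -
      have 1: "(\<lambda>j. fourier_coeff m (a j) - fourier_coeff' m (a j)) sums (fourier_coeff m A - fourier_coeff' m A)"
        unfolding A_def[abs_def] by (intro sums_diff fourier_coeff_suminf[OF a aK])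
      have "(\<lambda>j. fourier_coeff m (g j)) \<longlonglongrightarrow> 0"
      proof (rule Lim_null_comparison)
        show "\<forall>\<^sub>F j in sequentially. norm (fourier_coeff m (g j)) \<le> 2 * b * tv k * (1/2) ^ j"
        proof (intro always_eventually allI)
          fix j
          have "norm (fourier_coeff m (g j)) \<le> 2 * b * tv (g j)" by (rule fourier_coeff_le[OF g])
          also have "\<dots> \<le> 2 * b * (tv k * (1/2)^j)" using b_gt by (intro mult_left_mono g_tv) auto
          finally show "norm (fourier_coeff m (g j)) \<le> 2 * b * tv k * (1/2) ^ j" by (simp add: mult.assoc)
        qed
        show "(\<lambda>j. 2 * b * tv k * (1/2) ^ j) \<longlonglongrightarrow> 0"
          by (intro tendsto_mult_right_zero LIMSEQ_realpow_zero) auto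
      qed
      then have 2: "(\<lambda>j. fourier_coeff m (g j) - fourier_coeff m (g (Suc j))) sums (fourier_coeff m k - 0)"
        using telescope_sums'[of "\<lambda>j. fourier_coeff m (g j)" 0] by (simp add: g_def)
      have 3: "(\<lambda>j. \<Sum>i<n. increment i (g j) *\<^sub>R fourier_coeff m ((transfer ^^ p) (psi i))) sums (\<Sum>i<n. L i *\<^sub>R fourier_coeff m ((transfer ^^ p) (psi i)))"
        unfolding L_def by (intro sums_sum sums_scaleR_left summable_sums sl)
      from sums_unique2[OF 1 sums_diff[OF 2 3, folded fin]]
      show ?thesis by (simp add: fk sum_negf)
    qed
    moreover have "integrable lborel A" unfolding A_def[abs_def] by (rule fourier_coeff_suminf[OF a aK])
    moreover have "\<forall>x. b \<le> \<bar>x\<bar> \<longrightarrow> A x = 0" unfolding A_def using C1_supp_zero[OF a] by simp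
    ultimately show "\<exists>A L. integrable lborel A \<and> (\<forall>x. b \<le> \<bar>x\<bar> \<longrightarrow> A x = 0) \<and>
       (\<forall>m. fourier_coeff m A - fourier_coeff' m A + fourier_coeff m h = (\<Sum>i<n. L i *\<^sub>R - fourier_coeff m ((transfer ^^ p) (psi i))))"
      by blast
  qed
qed

end

section \<open>Measures on the hyperbola\<close>

text \<open>The value \<open>hyperbola 0 = (0, 0)\<close> lies off the curve; a single parameter is negligible.\<close>

definition hyperbola :: "real \<Rightarrow> real \<times> real" where "hyperbola t = (t, 1 / t)"

text \<open>The image of f dt under the parametrization: \<open>f\<close> is a density in
  \<open>t\<close>, not in arc length. The value 0 off the Borel sets is the convention of
  \<open>complex_borel_measure\<close>.\<close>

definition hyperbola_measure :: "(real \<Rightarrow> real) \<Rightarrow> (real \<times> real) set \<Rightarrow> complex" where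
  "hyperbola_measure f A = (if A \<in> sets borel
     then complex_of_real (\<integral>t. f t * indicator A (hyperbola t) \<partial>lborel) else 0)"

lemma hyperbola_measurable [measurable]: "hyperbola \<in> borel_measurable borel"
  unfolding hyperbola_def[abs_def] by (intro borel_measurable_Pair) measurable

lemma hyperbola_indicator_measurable [measurable]:
  "A \<in> sets borel \<Longrightarrow> (\<lambda>t. indicator A (hyperbola t) :: real) \<in> borel_measurable borel"
  by (rule measurable_compose[OF hyperbola_measurable]) simp

lemma hyperbola_integrable:
  assumes "integrable lborel f" "A \<in> sets borel"
  shows "integrable lborel (\<lambda>t. f t * indicator A (hyperbola t) :: real)"
proof (rule Bochner_Integration.integrable_bound[OF assms(1)])
  note [measurable] = borel_measurable_integrable[OF assms(1)] assms(2)
  show "(\<lambda>t. f t * indicator A (hyperbola t) :: real) \<in> borel_measurable lborel" by measurable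
qed (auto simp: indicator_def)

text \<open>Countable additivity is dominated convergence with majorant |f|, since disjointness
  keeps the sum of the indicators at most 1.\<close>

lemma complex_borel_measure_hyperbola:
  assumes "integrable lborel f"
  shows "complex_borel_measure (hyperbola_measure f)"
  unfolding complex_borel_measure_def
proof (intro conjI allI impI)
  fix A :: "nat \<Rightarrow> (real \<times> real) set"
  assume A: "range A \<subseteq> sets borel" "disjoint_family A"
  note [measurable] = borel_measurable_integrable[OF assms]
  have Am [measurable]: "A n \<in> sets borel" for n using A(1) by auto
  define s where "s N t = (\<Sum>n<N. f t * indicator (A n) (hyperbola t))" for N t
  have "(\<lambda>N. \<integral>t. s N t \<partial>lborel) \<longlonglongrightarrow> (\<integral>t. f t * indicator (\<Union>n. A n) (hyperbola t) \<partial>lborel)"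
  proof (rule integral_dominated_convergence[where w="\<lambda>t. \<bar>f t\<bar>"])
    have ind: "(\<lambda>n. indicator (A n) x :: real) sums indicator (\<Union>n. A n) x" for x
      using A(2) by (intro indicator_sums) (auto simp: disjoint_family_on_def)
    show "AE t in lborel. (\<lambda>N. s N t) \<longlonglongrightarrow> f t * indicator (\<Union>n. A n) (hyperbola t)"
      unfolding s_def sums_def[symmetric] by (intro always_eventually allI sums_mult ind)
    show "AE t in lborel. norm (s N t) \<le> \<bar>f t\<bar>" for N
    proof (intro always_eventually allI)
      fix t
      have "(\<Sum>n<N. indicator (A n) (hyperbola t) :: real) \<le> indicator (\<Union>n. A n) (hyperbola t)"
        using sum_le_suminf[OF sums_summable[OF ind], of "{..<N}" "hyperbola t"] sums_unique[OF ind] by simp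
      also have "\<dots> \<le> 1" by (simp add: indicator_def)
      finally have "\<bar>f t\<bar> * (\<Sum>n<N. indicator (A n) (hyperbola t)) \<le> \<bar>f t\<bar>" by (intro mult_left_le) auto
      then show "norm (s N t) \<le> \<bar>f t\<bar>"
        by (simp add: s_def abs_mult sum_nonneg flip: sum_distrib_left)
    qed
    show "s N \<in> borel_measurable lborel" for N unfolding s_def[abs_def] by measurable
  qed (use assms in auto)
  moreover have "(\<integral>t. s N t \<partial>lborel) = (\<Sum>n<N. \<integral>t. f t * indicator (A n) (hyperbola t) \<partial>lborel)" for N
    unfolding s_def by (intro Bochner_Integration.integral_sum hyperbola_integrable assms Am)
  ultimately have "(\<lambda>n. \<integral>t. f t * indicator (A n) (hyperbola t) \<partial>lborel) sums (\<integral>t. f t * indicator (\<Union>n. A n) (hyperbola t) \<partial>lborel)"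
    by (simp add: sums_def)
  then show "(\<lambda>n. hyperbola_measure f (A n)) sums hyperbola_measure f (\<Union>n. A n)"
    by (simp add: hyperbola_measure_def sums_of_real_iff)
qed (auto simp: hyperbola_measure_def)

text \<open>Hahn decomposition: the supremum is attained on the part of \<open>A\<close> that lies
  over {f > 0}. That part is a Borel set of the plane because the curve is a graph over the first
  coordinate, so \<open>fst\<close> recovers \<open>t\<close>.\<close>

lemma jordan_pos_hyperbola:
  assumes "integrable lborel f"
  shows "jordan_pos (\<lambda>A. Re (hyperbola_measure f A)) = distr (density lborel (\<lambda>t. ennreal (max 0 (f t)))) borel hyperbola"
    (is "?J = ?P")
proof -
  note [measurable] = borel_measurable_integrable[OF assms]
  have fm: "f \<in> borel_measurable borel" using borel_measurable_integrable[OF assms] by simp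
  have ip: "integrable lborel (\<lambda>t. max 0 (f t))" using assms by simp
  have em: "emeasure ?P A = ennreal (\<integral>t. max 0 (f t) * indicator A (hyperbola t) \<partial>lborel)" if [measurable]: "A \<in> sets borel" for A
  proof -
    have "emeasure ?P A = (\<integral>\<^sup>+ t. ennreal (max 0 (f t)) * indicator (hyperbola -` A) t \<partial>lborel)"
      using measurable_sets[OF hyperbola_measurable that] by (subst emeasure_distr) (simp_all add: emeasure_density)
    also have "\<dots> = (\<integral>\<^sup>+ t. ennreal (max 0 (f t) * indicator A (hyperbola t)) \<partial>lborel)"
      by (intro nn_integral_cong) (auto simp: indicator_def)
    also have "\<dots> = ennreal (\<integral>t. max 0 (f t) * indicator A (hyperbola t) \<partial>lborel)"
      by (intro nn_integral_eq_integral hyperbola_integrable ip that) (auto simp: indicator_def)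
    finally show ?thesis .
  qed
  have "(SUP B\<in>{B \<in> sets borel. B \<subseteq> A}. ennreal (Re (hyperbola_measure f B))) = emeasure ?P A"
    if A: "A \<in> sets borel" for A
  proof (rule antisym)
    show "(SUP B\<in>{B \<in> sets borel. B \<subseteq> A}. ennreal (Re (hyperbola_measure f B))) \<le> emeasure ?P A"
    proof (rule SUP_least)
      fix B assume "B \<in> {B \<in> sets borel. B \<subseteq> A}"
      then have B: "B \<in> sets borel" "B \<subseteq> A" by auto
      have "(\<integral>t. f t * indicator B (hyperbola t) \<partial>lborel) \<le> (\<integral>t. max 0 (f t) * indicator A (hyperbola t) \<partial>lborel)"
        by (intro integral_mono hyperbola_integrable assms ip A B) (use B in \<open>auto simp: indicator_def\<close>)
      then show "ennreal (Re (hyperbola_measure f B)) \<le> emeasure ?P A"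
        using B by (simp add: em[OF A] hyperbola_measure_def ennreal_leI)
    qed
    let ?B = "A \<inter> fst -` {t. 0 < f t}"
    have Bm: "?B \<in> sets borel"
    proof -
      have "{t. 0 < f t} \<in> sets borel" using fm by measurable
      then have "fst -` {t. 0 < f t} \<inter> space borel \<in> sets (borel :: (real \<times> real) measure)"
        by (rule measurable_sets[rotated]) (simp flip: borel_prod)
      then show ?thesis using A by auto
    qed
    have "(\<lambda>t. f t * indicator ?B (hyperbola t)) = (\<lambda>t. max 0 (f t) * indicator A (hyperbola t))"
      by (auto simp: fun_eq_iff indicator_def hyperbola_def)
    then have "emeasure ?P A = ennreal (Re (hyperbola_measure f ?B))"
      using Bm by (simp add: em[OF A] hyperbola_measure_def)
    also have "\<dots> \<le> (SUP B\<in>{B \<in> sets borel. B \<subseteq> A}. ennreal (Re (hyperbola_measure f B)))"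
      by (rule SUP_upper) (use Bm in auto)
    finally show "emeasure ?P A \<le> \<dots>" .
  qed
  then have "?J = measure_of UNIV (sets borel) (emeasure ?P)"
    unfolding jordan_pos_def
    by (intro measure_of_eq) (auto simp: sets.sigma_sets_eq[of borel, simplified])
  also have "\<dots> = ?P" using measure_of_of_measure[of ?P] by simp
  finally show ?thesis .
qed

lemma integral_jordan_pos_hyperbola:
  fixes F :: "real \<times> real \<Rightarrow> complex"
  assumes "integrable lborel f" "F \<in> borel_measurable borel"
  shows "(\<integral>x. F x \<partial>jordan_pos (\<lambda>A. Re (hyperbola_measure f A))) = (\<integral>t. max 0 (f t) *\<^sub>R F (hyperbola t) \<partial>lborel)"
proof -
  note [measurable] = borel_measurable_integrable[OF assms(1)] assms(2)
  show ?thesis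
    unfolding jordan_pos_hyperbola[OF assms(1)]
    by (subst integral_distr, simp_all, subst integral_density) auto
qed

lemma hyperbola_measure_uminus: "hyperbola_measure (\<lambda>t. - f t) A = - hyperbola_measure f A"
  by (simp add: hyperbola_measure_def)

lemma signed_integral_hyperbola:
  fixes F :: "real \<times> real \<Rightarrow> complex"
  assumes f: "integrable lborel f" and F: "F \<in> borel_measurable borel" "\<And>x. norm (F x) \<le> 1"
  shows "signed_integral (\<lambda>A. Re (hyperbola_measure f A)) F = (\<integral>t. f t *\<^sub>R F (hyperbola t) \<partial>lborel)"
proof -
  have Fh: "(\<lambda>t. F (hyperbola t)) \<in> borel_measurable borel"
    by (rule measurable_compose[OF hyperbola_measurable F(1)])
  have i: "integrable lborel (\<lambda>t. g t *\<^sub>R F (hyperbola t))" if "integrable lborel g" for g :: "real \<Rightarrow> real"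
  proof (rule Bochner_Integration.integrable_bound[OF that])
    show "(\<lambda>t. g t *\<^sub>R F (hyperbola t)) \<in> borel_measurable lborel"
      using Fh borel_measurable_integrable[OF that] by simp
    show "AE t in lborel. norm (g t *\<^sub>R F (hyperbola t)) \<le> norm (g t)"
      by (intro always_eventually allI) (simp add: mult_left_le F(2))
  qed
  have fm: "integrable lborel (\<lambda>t. - f t)" using f by simp
  have "signed_integral (\<lambda>A. Re (hyperbola_measure f A)) F
      = (\<integral>t. max 0 (f t) *\<^sub>R F (hyperbola t) \<partial>lborel) - (\<integral>t. max 0 (- f t) *\<^sub>R F (hyperbola t) \<partial>lborel)"
    unfolding signed_integral_def integral_jordan_pos_hyperbola[OF f F(1)]
    using integral_jordan_pos_hyperbola[OF fm F(1)] by (simp add: hyperbola_measure_uminus)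
  also have "\<dots> = (\<integral>t. max 0 (f t) *\<^sub>R F (hyperbola t) - max 0 (- f t) *\<^sub>R F (hyperbola t) \<partial>lborel)"
    by (intro Bochner_Integration.integral_diff[symmetric] i) (use f in auto)
  also have "\<dots> = (\<integral>t. f t *\<^sub>R F (hyperbola t) \<partial>lborel)"
    by (intro Bochner_Integration.integral_cong refl) (simp add: max_def flip: scaleR_diff_left)
  finally show ?thesis .
qed

lemma fourier_transform_hyperbola:
  assumes f: "integrable lborel f"
  shows "fourier_transform (hyperbola_measure f) (x1, x2) =
    (\<integral>t. f t *\<^sub>R exp (\<i> * complex_of_real (pi * (x1 * t + x2 / t))) \<partial>lborel)"
proof -
  let ?F = "\<lambda>y. exp (\<i> * complex_of_real (pi * (x1 * fst y + x2 * snd y)))"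
  have F: "?F \<in> borel_measurable borel"
    by (intro borel_measurable_continuous_onI continuous_intros)
  have n: "norm (?F y) \<le> 1" for y unfolding norm_exp_i_times by simp
  \<comment> \<open>The density is real, so the imaginary part is the zero measure, presented with
    zero density to fit \<open>signed_integral_hyperbola\<close>.\<close>
  have "(\<lambda>A. Im (hyperbola_measure f A)) = (\<lambda>A. Re (hyperbola_measure (\<lambda>t. 0) A))"
    by (auto simp: hyperbola_measure_def)
  then have "signed_integral (\<lambda>A. Im (hyperbola_measure f A)) ?F = 0"
    using signed_integral_hyperbola[of "\<lambda>t. 0" ?F] F n by simp
  then show ?thesis
    unfolding fourier_transform_def cmeasure_integral_def
    using signed_integral_hyperbola[OF f F n] by (simp add: hyperbola_def)
qed

section \<open>The hyperbola as a smooth curve and absolute continuity\<close>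

lemma components_minus_0: "components (- {0::real}) \<subseteq> {{..<0}, {0<..}}"
proof
  fix C assume C: "C \<in> components (- {0::real})"
  have conn: "connected C" and ne: "C \<noteq> {}" and sub: "C \<subseteq> - {0}"
    using C in_components_connected in_components_nonempty in_components_subset by blast+
  have "C \<subseteq> {..<0} \<or> C \<subseteq> {0<..}"
  proof (rule ccontr)
    assume "\<not> ?thesis"
    then obtain x y where "x \<in> C" "0 \<le> x" "y \<in> C" "y \<le> 0" by (meson greaterThan_iff lessThan_iff not_le subsetI)
    then have "0 \<in> C" using conn unfolding connected_iff_interval by blast
    then show False using sub by auto
  qed
  then show "C \<in> {{..<0}, {0<..}}"
  proof
    assume "C \<subseteq> {..<0}"
    moreover from this have "{..<0} \<subseteq> C"
      using ne by (intro components_maximal[OF C]) auto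
    ultimately show ?thesis by auto
  next
    assume "C \<subseteq> {0<..}"
    moreover from this have "{0<..} \<subseteq> C"
      using ne by (intro components_maximal[OF C]) auto
    ultimately show ?thesis by auto
  qed
qed

text \<open>The pair for index \<open>n\<close> is the n-th derivative of \<open>(t, 1 / t)\<close>;
  this closed form provides the whole sequence that smoothness asks for.\<close>

lemma hyperbola_has_vector_derivative:
  assumes "t \<noteq> 0"
  shows "(((\<lambda>t. (if n = 0 then t else if n = 1 then 1 else 0, (- 1) ^ n * fact n / t ^ Suc n)) :: real \<Rightarrow> real \<times> real)
    has_vector_derivative (if Suc n = 1 then 1 else 0, (- 1) ^ Suc n * fact (Suc n) / t ^ Suc (Suc n))) (at t within I)"
proof (rule has_vector_derivative_Pair)
  show "((\<lambda>t. if n = 0 then t else if n = 1 then 1 else 0) has_vector_derivative (if Suc n = 1 then 1 else (0::real))) (at t within I)"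
    by (cases "n = 0") (auto intro!: derivative_eq_intros simp flip: has_real_derivative_iff_has_vector_derivative)
  have "((\<lambda>t. (- 1) ^ n * fact n * inverse (t ^ Suc n)) has_real_derivative
      (- 1) ^ n * fact n * (- (inverse (t ^ Suc n) * (real (Suc n) * t ^ n) * inverse (t ^ Suc n)))) (at t within I)"
    using assms DERIV_power[OF DERIV_ident, of "Suc n" t I]
    by (intro DERIV_cmult DERIV_inverse') auto
  also have "(- 1) ^ n * fact n * (- (inverse (t ^ Suc n) * (real (Suc n) * t ^ n) * inverse (t ^ Suc n)))
      = (- 1) ^ Suc n * fact (Suc n) / t ^ Suc (Suc n)"
    using assms by (simp add: field_simps)
  finally show "((\<lambda>t. (- 1) ^ n * fact n / t ^ Suc n) has_vector_derivative (- 1) ^ Suc n * fact (Suc n) / t ^ Suc (Suc n)) (at t within I)"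
    unfolding has_real_derivative_iff_has_vector_derivative by (simp add: divide_inverse)
qed

lemma smooth_curves_param_hyperbola: "smooth_curves_param {(x1, x2). x1 * x2 = 1} (- {0}) hyperbola"
  unfolding smooth_curves_param_def
proof (intro conjI)
  show "finite (components (- {0::real}))"
    by (rule finite_subset[OF components_minus_0]) simp
  show "\<forall>C\<in>components (- {0::real}). infinite C"
    using components_minus_0 infinite_Iio infinite_Ioi by blast
  show "inj_on hyperbola (- {0})" by (auto simp: inj_on_def hyperbola_def)
  show "hyperbola ` (- {0}) = {(x1, x2). x1 * x2 = 1}"
  proof (intro set_eqI iffI)
    fix p :: "real \<times> real" assume "p \<in> {(x1, x2). x1 * x2 = 1}"
    then have "fst p * snd p = 1" by auto
    moreover from this have nz: "fst p \<noteq> 0" by auto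
    ultimately have "snd p = 1 / fst p" by (simp add: field_simps)
    then show "p \<in> hyperbola ` (- {0})" using nz by (intro image_eqI[of _ _ "fst p"]) (auto simp: hyperbola_def prod_eq_iff)
  qed (auto simp: hyperbola_def split: if_splits)
  let ?D = "\<lambda>n t. (if n = 0 then t else if n = 1 then 1 else 0, (- 1) ^ n * fact n / t ^ Suc n) :: real \<times> real"
  show "\<exists>D. D 0 = hyperbola \<and>
        (\<forall>n. \<forall>t\<in>- {0}. (D n has_vector_derivative D (Suc n) t) (at t within - {0})) \<and>
        (\<forall>t\<in>- {0}. D 1 t \<noteq> 0)"
  proof (intro exI[of _ ?D] conjI allI ballI)
    fix n and t :: real assume "t \<in> - {0}"
    then show "(?D n has_vector_derivative ?D (Suc n) t) (at t within - {0})"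
      using hyperbola_has_vector_derivative[of t n "- {0}"] by simp
  qed (auto simp: hyperbola_def fun_eq_iff zero_prod_def)
qed

text \<open>The speed never vanishes, so the preimage of a set of zero arc length is Lebesgue null,
  up to the single parameter 0.\<close>

lemma abs_cont_hyperbola:
  assumes f: "integrable lborel f"
  shows "abs_cont_arc_length {(x1, x2). x1 * x2 = 1} (hyperbola_measure f)"
  unfolding abs_cont_arc_length_def
proof (intro exI conjI ballI)
  show "smooth_curves_param {(x1, x2). x1 * x2 = 1} (- {0}) hyperbola" by (rule smooth_curves_param_hyperbola)
  let ?R = "restrict_space lborel (- {0::real})"
  let ?n = "\<lambda>t. ennreal (norm (vector_derivative hyperbola (at t within - {0})))"
  fix A assume A: "A \<in> null_sets (arc_length_measure (- {0}) hyperbola)"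
  have vd: "vector_derivative hyperbola (at t within - {0}) = (1, - 1 / t^2)" if "t \<in> - {0}" for t
  proof (rule vector_derivative_within)
    have "at t within - {0} = at t" by (rule at_within_open) (use that in auto)
    then show "at t within - {0} \<noteq> bot" by simp
    show "(hyperbola has_vector_derivative (1, - 1 / t^2)) (at t within - {0})"
      using hyperbola_has_vector_derivative[of t 0 "- {0}"] that by (simp add: hyperbola_def[abs_def] power2_eq_square)
  qed
  have nm: "?n \<in> borel_measurable ?R"
  proof -
    have "(\<lambda>t. ennreal (norm (1::real, - 1 / t^2 :: real))) \<in> borel_measurable ?R"
      by (intro measurable_restrict_space1) (simp add: norm_Pair)
    then show ?thesis by (rule measurable_cong[THEN iffD1, rotated]) (simp add: vd space_restrict_space)
  qed
  have hm: "hyperbola \<in> measurable (density ?R ?n) borel"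
    using measurable_restrict_space1[of hyperbola lborel borel] by simp
  have Ab: "A \<in> sets borel" and "emeasure (density ?R ?n) (hyperbola -` A \<inter> space (density ?R ?n)) = 0"
    using A by (auto simp: null_sets_def arc_length_measure_def emeasure_distr[OF hm])
  then have "hyperbola -` A \<inter> space ?R \<in> null_sets (density ?R ?n)"
    using measurable_sets[OF hm Ab] by (auto simp: null_sets_def)
  then have "AE t in ?R. t \<in> hyperbola -` A \<inter> space ?R \<longrightarrow> ?n t = 0"
    unfolding null_sets_density_iff[OF nm] by blast
  then have "AE t in lborel. t \<in> - {0} \<longrightarrow> hyperbola t \<in> A \<longrightarrow> ?n t = 0"
    by (subst (asm) AE_restrict_space_iff) (auto simp: space_restrict_space elim!: eventually_mono)
  then have "AE t in lborel. f t * indicator A (hyperbola t) = 0"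
    using AE_lborel_singleton[of "0::real"]
  proof eventually_elim
    case (elim t)
    have "hyperbola t \<notin> A"
    proof
      assume "hyperbola t \<in> A"
      then have "norm (vector_derivative hyperbola (at t within - {0})) = 0" using elim by simp
      then show False using vd[of t] elim by (simp add: zero_prod_def)
    qed
    then show ?case by simp
  qed
  then have "(\<integral>t. f t * indicator A (hyperbola t) \<partial>lborel) = 0" by (rule integral_eq_zero_AE)
  then show "hyperbola_measure f A = 0" by (simp add: hyperbola_measure_def)
qed

lemma hyperbola_measure_in_AC:
  assumes f: "integrable lborel f"
    and "\<And>x1 x2. (x1, x2) \<in> \<Lambda> \<Longrightarrow>
      (\<integral>t. f t *\<^sub>R exp (\<i> * complex_of_real (pi * (x1 * t + x2 / t))) \<partial>lborel) = 0"
  shows "hyperbola_measure f \<in> AC {(x1, x2). x1 * x2 = 1} \<Lambda>"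
proof -
  have "hyperbola_measure f A = 0" if A: "A \<in> sets borel" "A \<inter> {(x1, x2). x1 * x2 = 1} = {}" for A
  proof -
    have "AE t in lborel. f t * indicator A (hyperbola t) = 0"
      using AE_lborel_singleton[of "0::real"]
    proof eventually_elim
      case (elim t)
      then have "hyperbola t \<in> {(x1, x2). x1 * x2 = 1}" by (simp add: hyperbola_def)
      with A(2) have "hyperbola t \<notin> A" unfolding disjoint_iff by (metis (no_types))
      then show ?case by simp
    qed
    then show ?thesis by (simp add: hyperbola_measure_def integral_eq_zero_AE)
  qed
  then show ?thesis
    unfolding AC_def using complex_borel_measure_hyperbola[OF f] abs_cont_hyperbola[OF f] assms(2)
    by (auto simp: fourier_transform_hyperbola[OF f])
qed

section \<open>Independent solutions\<close>

text \<open>Gaussian elimination by induction on the equations: the pivot unknown \<open>p\<close>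
  is eliminated from the remaining equations and finally determined by equation
  \<open>e\<close>.\<close>

lemma underdetermined_system:
  fixes L :: "'j \<Rightarrow> 'i \<Rightarrow> 'a::field"
  assumes "finite I" "finite J" "card I < card J"
  shows "\<exists>\<kappa>. (\<exists>j\<in>J. \<kappa> j \<noteq> 0) \<and> (\<forall>i\<in>I. (\<Sum>j\<in>J. \<kappa> j * L j i) = 0)"
  using assms
proof (induction I arbitrary: J L rule: finite_induct)
  case empty
  then have "J \<noteq> {}" by auto
  then show ?case by (intro exI[of _ "\<lambda>_. 1"]) auto
next
  case (insert e I)
  show ?case
  proof (cases "\<exists>p\<in>J. L p e \<noteq> 0")
    case False
    then show ?thesis using insert.IH[of J L] insert.prems insert.hyps by auto
  next
    case True
    then obtain p where p: "p \<in> J" "L p e \<noteq> 0" by blast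
    define L' where "L' j i = L j i - L j e / L p e * L p i" for j i
    have "card I < card (J - {p})" using insert p by simp
    then obtain \<kappa> where \<kappa>: "\<exists>j\<in>J - {p}. \<kappa> j \<noteq> 0" "\<And>i. i \<in> I \<Longrightarrow> (\<Sum>j\<in>J - {p}. \<kappa> j * L' j i) = 0"
      using insert.IH[of "J - {p}" L'] insert.prems by auto
    define \<kappa>' where "\<kappa>' j = (if j = p then - (\<Sum>j\<in>J - {p}. \<kappa> j * (L j e / L p e)) else \<kappa> j)" for j
    have s: "(\<Sum>j\<in>J. \<kappa>' j * L j i) = (\<Sum>j\<in>J - {p}. \<kappa> j * L' j i)" for i
    proof -
      have "(\<Sum>j\<in>J. \<kappa>' j * L j i) = \<kappa>' p * L p i + (\<Sum>j\<in>J - {p}. \<kappa> j * L j i)"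
        using insert.prems p by (simp add: sum.remove[of J p] \<kappa>'_def)
      also have "\<dots> = (\<Sum>j\<in>J - {p}. \<kappa> j * L' j i)"
        by (simp add: L'_def \<kappa>'_def sum_distrib_left sum_subtractf algebra_simps)
      finally show ?thesis .
    qed
    have "(\<Sum>j\<in>J. \<kappa>' j * L j e) = 0" unfolding s L'_def using p by simp
    then have "\<forall>i\<in>insert e I. (\<Sum>j\<in>J. \<kappa>' j * L j i) = 0" using s \<kappa>(2) by auto
    moreover have "\<exists>j\<in>J. \<kappa>' j \<noteq> 0" using \<kappa>(1) by (auto simp: \<kappa>'_def)
    ultimately show ?thesis by blast
  qed
qed

text \<open>Evaluations at the sets \<open>A q\<close> are biorthogonal to the measures up to
  nonzero factors, so the measures are independent and no finite set spans them.\<close>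

lemma infinite_dimensionalI:
  fixes \<mu> :: "nat \<Rightarrow> 'a set \<Rightarrow> complex"
  assumes V: "\<And>q. \<mu> q \<in> V" and nz: "\<And>q. \<mu> q (A q) \<noteq> 0" and z: "\<And>q q'. q \<noteq> q' \<Longrightarrow> \<mu> q' (A q) = 0"
  shows "infinite_dimensional V"
  unfolding infinite_dimensional_def
proof
  assume "\<exists>B. finite B \<and> V \<subseteq> setfun.span B"
  then obtain B where B: "finite B" "V \<subseteq> setfun.span B" by blast
  have inj: "inj \<mu>" using nz z by (metis injI)
  have sum_apply: "(\<Sum>v\<in>T. scale_setfun (u v) v) X = (\<Sum>v\<in>T. u v * v X)" for T u X
    by (induction T rule: infinite_finite_induct) (auto simp: scale_setfun_def)
  have "\<not> setfun.dependent (range \<mu>)"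
    unfolding setfun.dependent_explicit
  proof safe
    fix T u v assume T: "finite T" "T \<subseteq> range \<mu>" "(\<Sum>v\<in>T. scale_setfun (u v) v) = 0" "v \<in> T" "u v \<noteq> 0"
    then obtain q where q: "v = \<mu> q" by auto
    have "(\<Sum>w\<in>T. u w * w (A q)) = u v * v (A q)"
    proof (rule sum.remove[OF T(1,4), THEN trans])
      have "u w * w (A q) = 0" if w: "w \<in> T - {v}" for w
      proof -
        obtain q' where "w = \<mu> q'" "q' \<noteq> q" using w T(2) q by blast
        then show ?thesis using z[of q q'] by simp
      qed
      then have "(\<Sum>w\<in>T - {v}. u w * w (A q)) = 0" by (intro sum.neutral) blast
      then show "u v * v (A q) + (\<Sum>w\<in>T - {v}. u w * w (A q)) = u v * v (A q)" by simp
    qed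
    then have "u v * v (A q) = 0" using sum_apply[of u T "A q"] T(3) by simp
    then show False using T(5) nz q by simp
  qed
  then have "finite (range \<mu>)"
    using setfun.independent_span_bound[OF B(1), of "range \<mu>"] V B(2) by blast
  then show False using inj finite_imageD by blast
qed

section \<open>Bumps in the gap and the family of solutions\<close>

definition bump :: "real \<Rightarrow> real \<Rightarrow> real \<Rightarrow> real" where
  "bump u v x = pos2 (x - u) * pos2 (v - x)"

lemma bump_C1_supp:
  assumes "0 \<le> u" "v \<le> r"
  shows "C1_supp r (bump u v)"
proof (rule C1_suppI(1))
  have 1: "((\<lambda>x. pos2 (x - u)) has_real_derivative 2 * max 0 (x - u)) (at x)" for x
  proof -
    have "((\<lambda>x. x - u) has_real_derivative 1) (at x)" by (auto intro!: derivative_eq_intros)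
    from DERIV_chain2[OF pos2_DERIV this] show ?thesis by simp
  qed
  have 2: "((\<lambda>x. pos2 (v - x)) has_real_derivative - (2 * max 0 (v - x))) (at x)" for x
  proof -
    have "((\<lambda>x. v - x) has_real_derivative - 1) (at x)" by (auto intro!: derivative_eq_intros)
    from DERIV_chain2[OF pos2_DERIV this] show ?thesis by simp
  qed
  show "(bump u v has_real_derivative 2 * max 0 (x - u) * pos2 (v - x) + - (2 * max 0 (v - x)) * pos2 (x - u)) (at x)" for x
    unfolding bump_def[abs_def] by (rule DERIV_mult[OF 1 2])
  show "continuous_on UNIV (\<lambda>x. 2 * max 0 (x - u) * pos2 (v - x) + - (2 * max 0 (v - x)) * pos2 (x - u))"
    unfolding pos2_def by (intro continuous_intros)
  fix x assume "r \<le> \<bar>x\<bar>"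
  then have "x \<le> u \<or> v \<le> x" using assms by auto
  then show "bump u v x = 0" "2 * max 0 (x - u) * pos2 (v - x) + - (2 * max 0 (v - x)) * pos2 (x - u) = 0"
    by (auto simp: bump_def pos2_def)
qed

lemma bump_pos: "u < x \<Longrightarrow> x < v \<Longrightarrow> 0 < bump u v x"
  and bump_zero: "x \<le> u \<or> v \<le> x \<Longrightarrow> bump u v x = 0"
  and bump_nonneg: "0 \<le> bump u v x"
  by (auto simp: bump_def pos2_def)

context expanding
begin

text \<open>\<open>f = A - flip c A + h\<close> with \<open>h = h0 - flip c h0\<close> is anti-invariant under the isometry
  \<open>flip c\<close>, so one family of conditions takes care of both axes of the expanding-cross.\<close>

lemma anti_invariant_extension:
  obtains n :: nat and V :: "nat \<Rightarrow> int \<Rightarrow> complex" where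
    "\<forall>h0. C1_supp (sqrt c) h0 \<longrightarrow> (\<exists>f L. integrable lborel f \<and> (\<forall>x\<in>{b<..<sqrt c}. f x = h0 x) \<and>
       (\<forall>m. fourier_coeff m f = (\<Sum>i<n. L i *\<^sub>R V i m)) \<and> (\<forall>m. fourier_coeff' m f = - fourier_coeff m f))"
proof -
  have s: "0 < sqrt c" "sqrt c * sqrt c = c" using c_pos by auto
  \<comment> \<open>\<open>sqrt c\<close> is fixed by t -> c / t, so the flip of a function
    supported in |x| <= sqrt c vanishes on that interval.\<close>
  have cs: "c / sqrt c = sqrt c" using s by (simp add: real_div_sqrt)
  obtain n :: nat and V :: "nat \<Rightarrow> int \<Rightarrow> complex" where ext: "\<forall>h. C1_decay h \<longrightarrow> (\<exists>A L. integrable lborel A \<and> (\<forall>x. b \<le> \<bar>x\<bar> \<longrightarrow> A x = 0) \<and>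
       (\<forall>m. fourier_coeff m A - fourier_coeff' m A + fourier_coeff m h = (\<Sum>i<n. L i *\<^sub>R V i m)))"
    by (rule solve_up_to_finite_rank) (rule that)
  show ?thesis
  proof (rule that[of V n], intro allI impI)
    fix h0 assume h0: "C1_supp (sqrt c) h0"
    define h where "h x = h0 x + (- 1) * flip c h0 x" for x
    have h: "C1_decay h" unfolding h_def
      by (intro C1_decay_lincomb C1_supp_C1_decay[OF h0] flip_C1_supp(1)[OF h0 s(1) c_pos])
    have ih: "integrable lborel h" using h by (simp add: C1_decay_def)
    obtain A L where A: "integrable lborel A" "\<And>x. b \<le> \<bar>x\<bar> \<Longrightarrow> A x = 0"
      and fA: "\<And>m. fourier_coeff m A - fourier_coeff' m A + fourier_coeff m h = (\<Sum>i<n. L i *\<^sub>R V i m)"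
      using ext h by blast
    define f where "f x = A x + (- 1 * flip c A x + h x)" for x
    have iA: "integrable lborel (\<lambda>x. - 1 * flip c A x)" using flip_integral(1)[OF c_pos A(1)] by simp
    have f: "integrable lborel f"
      unfolding f_def by (intro Bochner_Integration.integrable_add A(1) iA ih)
    have "f x = h0 x" if "x \<in> {b<..<sqrt c}" for x
    proof -
      have x: "0 < x" "b < x" "x < sqrt c" using that b_gt by auto
      \<comment> \<open>As \<open>b\<close> and \<open>x\<close> are both below
        \<open>sqrt c\<close>, the inverted point \<open>c / x\<close> lies beyond \<open>b\<close>,
        where \<open>A\<close> is zero; only \<open>h0\<close> remains at \<open>x\<close>.\<close>
      have "b * x \<le> sqrt c * sqrt c" using x b_gt c_pos by (intro mult_mono) auto
      then have "b \<le> c / x" using x s by (simp add: field_simps)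
      then have "A (c / x) = 0" by (intro A(2)) linarith
      then have "flip c A x = 0" by (simp add: flip_def)
      moreover have "flip c h0 x = 0" using flip_C1_supp(3)[OF h0 s(1) c_pos, of x] x by (simp add: cs)
      ultimately show ?thesis using A(2)[of x] x by (simp add: f_def h_def)
    qed
    moreover have ff: "fourier_coeff m f = (\<Sum>i<n. L i *\<^sub>R V i m)" for m
    proof -
      have "fourier_coeff m f = fourier_coeff m A + (fourier_coeff m (\<lambda>x. - 1 * flip c A x) + fourier_coeff m h)"
        unfolding f_def using fourier_coeff_add[OF A(1) Bochner_Integration.integrable_add[OF iA ih]] fourier_coeff_add[OF iA ih] by simp
      also have "fourier_coeff m (\<lambda>x. - 1 * flip c A x) = - fourier_coeff' m A"
        unfolding fourier_coeff_flip[OF A(1), symmetric] by (simp add: fourier_coeff_def)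
      finally show ?thesis unfolding fA[of m, symmetric] by simp
    qed
    moreover have "fourier_coeff' m f = - fourier_coeff m f" for m
    proof -
      \<comment> \<open>The flip is an involution only off 0, where its value is a convention; a
        single point does not affect the coefficients.\<close>
      have inv: "flip c (flip c g) x = g x" if "x \<noteq> 0" for g :: "real \<Rightarrow> real" and x
        using that c_pos by (simp add: flip_def field_simps power2_eq_square)
      have "flip c f x = - f x" if "x \<noteq> 0" for x
      proof -
        have "flip c f x = flip c A x - flip c (flip c A) x + (flip c h0 x - flip c (flip c h0) x)"
          by (simp add: flip_def f_def h_def algebra_simps diff_divide_distrib add_divide_distrib)
        then show ?thesis using that by (simp add: inv f_def h_def)
      qed
      then have "AE x in lborel. flip c f x *\<^sub>R exp (\<i> * complex_of_real (pi * (of_int m * x)))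
          = - (f x *\<^sub>R exp (\<i> * complex_of_real (pi * (of_int m * x))))"
        using AE_lborel_singleton[of "0::real"] by (auto elim!: eventually_mono)
      then have "fourier_coeff m (flip c f) = (\<integral>x. - (f x *\<^sub>R exp (\<i> * complex_of_real (pi * (of_int m * x)))) \<partial>lborel)"
        unfolding fourier_coeff_def
        by (intro integral_cong_AE borel_measurable_integrable Bochner_Integration.integrable_minus
            integrable_weight character f flip_integral(1)[OF c_pos f]) auto
      then show ?thesis unfolding fourier_coeff_flip[OF f] by (simp add: fourier_coeff_def)
    qed
    ultimately show "\<exists>f L. integrable lborel f \<and> (\<forall>x\<in>{b<..<sqrt c}. f x = h0 x) \<and>
       (\<forall>m. fourier_coeff m f = (\<Sum>i<n. L i *\<^sub>R V i m)) \<and> (\<forall>m. fourier_coeff' m f = - fourier_coeff m f)"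
      using f by blast
  qed
qed

text \<open>Decreases to \<open>b\<close> inside the gap (b, sqrt c), so consecutive breakpoints
  bound infinitely many disjoint intervals; the shift by 2 puts the first one strictly below
  \<open>sqrt c\<close>.\<close>

definition breakpoint :: "nat \<Rightarrow> real" where "breakpoint j = b + (sqrt c - b) / real (j + 2)"

lemma sqrt_c: "b < sqrt c"
  using b_c b_gt by (intro real_less_rsqrt) auto

lemma breakpoint_antimono: "i \<le> j \<Longrightarrow> breakpoint j \<le> breakpoint i"
  unfolding breakpoint_def using sqrt_c by (intro add_left_mono divide_left_mono) auto

lemma breakpoint_strict: "breakpoint (Suc j) < breakpoint j"
  unfolding breakpoint_def using sqrt_c by (intro add_strict_left_mono divide_strict_left_mono) auto

lemma breakpoint_bounds: "b < breakpoint j" "breakpoint j < sqrt c"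
proof -
  have "(sqrt c - b) / real (j + 2) < (sqrt c - b) / 1"
    using sqrt_c by (intro divide_strict_left_mono) auto
  then show "b < breakpoint j" "breakpoint j < sqrt c" using sqrt_c by (auto simp: breakpoint_def)
qed

text \<open>The finitely many obstructions are removed by combining finitely many bumps; disjoint
  blocks of bumps give independent solutions.\<close>

lemma independent_solutions:
  obtains f :: "nat \<Rightarrow> real \<Rightarrow> real" and u v :: "nat \<Rightarrow> real" where
    "\<And>q. integrable lborel (f q)" "\<And>q m. fourier_coeff m (f q) = 0" "\<And>q m. fourier_coeff' m (f q) = 0"
    "\<And>q. (\<integral>x. f q x * indicator {u q<..<v q} x \<partial>lborel) \<noteq> 0"
    "\<forall>q q'. q \<noteq> q' \<longrightarrow> (\<forall>x\<in>{u q<..<v q}. f q' x = 0)"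
proof -
  obtain n :: nat and V :: "nat \<Rightarrow> int \<Rightarrow> complex" where ext: "\<forall>h0. C1_supp (sqrt c) h0 \<longrightarrow> (\<exists>f L. integrable lborel f \<and> (\<forall>x\<in>{b<..<sqrt c}. f x = h0 x) \<and>
       (\<forall>m. fourier_coeff m f = (\<Sum>i<n. L i *\<^sub>R V i m)) \<and> (\<forall>m. fourier_coeff' m f = - fourier_coeff m f))"
    by (rule anti_invariant_extension) (rule that)
  let ?B = "\<lambda>j. bump (breakpoint (Suc j)) (breakpoint j)"
  have B: "C1_supp (sqrt c) (?B j)" for j
    using breakpoint_bounds[of "Suc j"] breakpoint_bounds[of j] b_gt by (intro bump_C1_supp) auto
  have "\<forall>j. \<exists>f L. integrable lborel f \<and> (\<forall>x\<in>{b<..<sqrt c}. f x = ?B j x) \<and>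
       (\<forall>m. fourier_coeff m f = (\<Sum>i<n. L i *\<^sub>R V i m)) \<and> (\<forall>m. fourier_coeff' m f = - fourier_coeff m f)"
    using ext B by blast
  from choice[OF this] obtain F where "\<forall>j. \<exists>L. integrable lborel (F j) \<and> (\<forall>x\<in>{b<..<sqrt c}. F j x = ?B j x) \<and>
       (\<forall>m. fourier_coeff m (F j) = (\<Sum>i<n. L i *\<^sub>R V i m)) \<and> (\<forall>m. fourier_coeff' m (F j) = - fourier_coeff m (F j))"
    by blast
  from choice[OF this] obtain L where *: "\<forall>j. integrable lborel (F j) \<and> (\<forall>x\<in>{b<..<sqrt c}. F j x = ?B j x) \<and>
       (\<forall>m. fourier_coeff m (F j) = (\<Sum>i<n. L j i *\<^sub>R V i m)) \<and> (\<forall>m. fourier_coeff' m (F j) = - fourier_coeff m (F j))"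
    by blast
  have F: "integrable lborel (F j)" and FB: "x \<in> {b<..<sqrt c} \<Longrightarrow> F j x = ?B j x"
    and FL: "fourier_coeff m (F j) = (\<Sum>i<n. L j i *\<^sub>R V i m)" and F': "fourier_coeff' m (F j) = - fourier_coeff m (F j)" for j m x
    using spec[OF *, of j] by simp_all
  \<comment> \<open>Disjoint blocks of \<open>Suc n\<close> indices, one more than the number of
    obstructions, so each block has a nontrivial combination free of them.\<close>
  define J where "J q = {q * Suc n..<Suc q * Suc n}" for q
  have Jc: "finite (J q)" "card (J q) = Suc n" for q by (auto simp: J_def)
  have Jd: "q = q'" if "j \<in> J q" "j \<in> J q'" for q q' j
    using that unfolding J_def by (metis atLeastLessThan_iff div_nat_eqI mult.commute)
  have "\<forall>q. \<exists>\<kappa>. (\<exists>j\<in>J q. \<kappa> j \<noteq> 0) \<and> (\<forall>i\<in>{..<n}. (\<Sum>j\<in>J q. \<kappa> j * L j i) = 0)"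
    using underdetermined_system[of "{..<n}" "J _" L] Jc by (auto simp: Jc)
  then obtain \<kappa> where \<kappa>1: "\<And>q. \<exists>j\<in>J q. \<kappa> q j \<noteq> 0" and \<kappa>2: "\<And>q i. i < n \<Longrightarrow> (\<Sum>j\<in>J q. \<kappa> q j * L j i) = 0"
    by (metis lessThan_iff)
  \<comment> \<open>A bump that really occurs in block \<open>q\<close>; its interval will isolate
    \<open>f q\<close> from the other solutions.\<close>
  from \<kappa>1 obtain p where p: "\<And>q. p q \<in> J q" "\<And>q. \<kappa> q (p q) \<noteq> 0" by metis
  define f where "f q x = (\<Sum>j\<in>J q. \<kappa> q j * F j x)" for q x
  have f0: "fourier_coeff m (f q) = 0" for q m
  proof -
    have "fourier_coeff m (f q) = (\<Sum>j\<in>J q. \<Sum>i<n. (\<kappa> q j * L j i) *\<^sub>R V i m)"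
      unfolding f_def by (simp add: fourier_coeff_sum Jc F FL scaleR_sum_right)
    also have "\<dots> = (\<Sum>i<n. (\<Sum>j\<in>J q. \<kappa> q j * L j i) *\<^sub>R V i m)"
      by (subst sum.swap) (simp add: scaleR_sum_left)
    finally show ?thesis using \<kappa>2 by simp
  qed
  have Bz: "?B j x = 0" if "x \<in> {breakpoint (Suc i)<..<breakpoint i}" "i \<noteq> j" for i j x
  proof (rule bump_zero)
    show "x \<le> breakpoint (Suc j) \<or> breakpoint j \<le> x"
    proof (cases "i < j")
      case True
      then show ?thesis using breakpoint_antimono[of "Suc i" j] that by auto
    next
      case False
      then show ?thesis using breakpoint_antimono[of "Suc j" i] that by auto
    qed
  qed
  have inb: "x \<in> {b<..<sqrt c}" if "x \<in> {breakpoint (Suc i)<..<breakpoint i}" for i x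
    using that breakpoint_bounds[of i] breakpoint_bounds[of "Suc i"] by auto
  \<comment> \<open>Inside the gap every \<open>F j\<close> is just its bump, so the blocks are
    separated there, whatever overlaps occur elsewhere.\<close>
  have fz: "f q' x = 0" if "q \<noteq> q'" "x \<in> {breakpoint (Suc (p q))<..<breakpoint (p q)}" for q q' x
    unfolding f_def
  proof (rule sum.neutral, rule ballI)
    fix j assume "j \<in> J q'"
    then have "p q \<noteq> j" using Jd p(1) that(1) by blast
    then show "\<kappa> q' j * F j x = 0" using FB[OF inb[OF that(2)]] Bz[OF that(2)] by simp
  qed
  have fB: "f q x = \<kappa> q (p q) * ?B (p q) x" if "x \<in> {breakpoint (Suc (p q))<..<breakpoint (p q)}" for q x
  proof -
    have "f q x = (\<Sum>j\<in>J q. if j = p q then \<kappa> q (p q) * ?B (p q) x else 0)"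
      unfolding f_def using FB[OF inb[OF that]] Bz[OF that] by (intro sum.cong) auto
    then show ?thesis using p(1) Jc by simp
  qed
  show ?thesis
  proof (rule that[of f "\<lambda>q. breakpoint (Suc (p q))" "\<lambda>q. breakpoint (p q)"])
    show "integrable lborel (f q)" for q
      unfolding f_def[abs_def] by (intro Bochner_Integration.integrable_sum integrable_mult_right F)
    show "fourier_coeff m (f q) = 0" for q m by (rule f0)
    show "fourier_coeff' m (f q) = 0" for q m
    proof -
      have "fourier_coeff' m (f q) = - fourier_coeff m (f q)"
        unfolding f_def by (simp add: fourier_coeff_sum Jc F F' sum_negf)
      then show ?thesis using f0 by simp
    qed
    show "\<forall>q q'. q \<noteq> q' \<longrightarrow> (\<forall>x\<in>{breakpoint (Suc (p q))<..<breakpoint (p q)}. f q' x = 0)"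
      using fz by blast
    show "(\<integral>x. f q x * indicator {breakpoint (Suc (p q))<..<breakpoint (p q)} x \<partial>lborel) \<noteq> 0" for q
    proof -
      let ?b = "?B (p q)" and ?u = "breakpoint (Suc (p q))" and ?v = "breakpoint (p q)"
      have "(\<integral>x. f q x * indicator {?u<..<?v} x \<partial>lborel) = (\<integral>x. \<kappa> q (p q) * ?b x \<partial>lborel)"
        using fB bump_zero by (intro Bochner_Integration.integral_cong refl) (auto simp: indicator_def not_less)
      also have "\<dots> = \<kappa> q (p q) * (\<integral>x. ?b x \<partial>lborel)" by simp
      finally have *: "(\<integral>x. f q x * indicator {?u<..<?v} x \<partial>lborel) = \<kappa> q (p q) * (\<integral>x. ?b x \<partial>lborel)" .
      have "(\<integral>x. ?b x \<partial>lborel) \<noteq> 0"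
      proof
        assume "(\<integral>x. ?b x \<partial>lborel) = 0"
        then have "AE x in lborel. ?b x = 0"
          using integral_nonneg_eq_0_iff_AE[OF C1_supp_integrable(1)[OF B[of "p q"]]] bump_nonneg by simp
        then have "AE x in lborel. x \<notin> {?u<..<?v}"
          by (rule eventually_mono) (use bump_pos in force)
        then have "emeasure lborel {?u<..<?v} = 0" by (subst (asm) AE_iff_null_sets[symmetric]) auto
        then show False using breakpoint_strict[of "p q"] by simp
      qed
      then show ?thesis using * p(2) by simp
    qed
  qed
qed

end

section \<open>Rescaling and conclusion\<close>

theorem theorem1p1:
  fixes \<alpha> \<beta> :: real and \<Gamma> :: "(real \<times> real) set"
  assumes "\<Gamma> = {(x1, x2). x1 * x2 = 1}"
    and "\<alpha> > 0" and "\<beta> > 0" and "\<alpha> * \<beta> > 1"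
  shows "infinite_dimensional (AC \<Gamma> (lattice_cross \<alpha> \<beta>))"
proof -
  \<comment> \<open>Both \<open>b < 2\<close> and \<open>b^2 < \<alpha> * \<beta>\<close> are wanted
    of some \<open>b > 1\<close>; the hypothesis on the product makes room for it.\<close>
  define s where "s = min 2 (sqrt (\<alpha> * \<beta>))"
  have "1 < s" using assms(4) by (simp add: s_def)
  then obtain b where b: "1 < b" "b < s" using dense by blast
  have "b^2 < sqrt (\<alpha> * \<beta>)^2" using b by (intro power_strict_mono) (auto simp: s_def)
  then have "b^2 < \<alpha> * \<beta>" using assms(4) by simp
  then interpret expanding b "\<alpha> * \<beta>" by unfold_locales (use b in \<open>auto simp: s_def\<close>)
  obtain F :: "nat \<Rightarrow> real \<Rightarrow> real" and u v :: "nat \<Rightarrow> real"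
    where F: "\<And>q. integrable lborel (F q)" "\<And>q m. fourier_coeff m (F q) = 0" "\<And>q m. fourier_coeff' m (F q) = 0"
    and nz: "\<And>q. (\<integral>x. F q x * indicator {u q<..<v q} x \<partial>lborel) \<noteq> (0::real)"
    and z: "\<forall>q q'. q \<noteq> q' \<longrightarrow> (\<forall>x\<in>{u q<..<v q}. F q' x = 0)"
    by (rule independent_solutions) (rule that)
  \<comment> \<open>With x = \<alpha> t the phase \<alpha> m t becomes m x, and \<beta> m / t
    becomes m c / x with c = \<alpha> \<beta>, which are the phases of \<open>fourier_coeff\<close>
    and \<open>fourier_coeff'\<close>.\<close>
  define f where "f q t = F q (\<alpha> * t)" for q t
  have fi: "integrable lborel (f q)" for q
    unfolding f_def[abs_def] using lborel_integrable_real_affine[OF F(1), of \<alpha> q 0] assms(2) by simp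
  have scale: "(\<integral>t. G (\<alpha> * t) \<partial>lborel) = (1 / \<alpha>) *\<^sub>R (\<integral>t. G t \<partial>lborel)"
    for G :: "real \<Rightarrow> 'b::{banach, second_countable_topology}"
    using lborel_integral_real_affine[of \<alpha> G 0] assms(2) by simp
  \<comment> \<open>The strip over the interval of the q-th solution. On the curve it selects the
    parameters with \<alpha> t in that interval, which gives the biorthogonality asked for by
    \<open>infinite_dimensionalI\<close>.\<close>
  define A where "A q = {p :: real \<times> real. \<alpha> * fst p \<in> {u q<..<v q}}" for q
  have Ab: "A q \<in> sets borel" for q
  proof -
    have "open (A q)" unfolding A_def greaterThanLessThan_iff
      by (intro open_Collect_conj open_Collect_less continuous_intros)
    then show ?thesis by simp
  qed
  have hA: "hyperbola_measure (f q') (A q) = complex_of_real ((1 / \<alpha>) * (\<integral>x. F q' x * indicator {u q<..<v q} x \<partial>lborel))" for q q'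
  proof -
    have "(\<integral>t. f q' t * indicator (A q) (hyperbola t) \<partial>lborel) = (\<integral>t. F q' (\<alpha> * t) * indicator {u q<..<v q} (\<alpha> * t) \<partial>lborel)"
      by (simp add: f_def A_def hyperbola_def indicator_def)
    then show ?thesis
      using scale[of "\<lambda>x. F q' x * indicator {u q<..<v q} x"] Ab by (simp add: hyperbola_measure_def)
  qed
  show ?thesis
  proof (rule infinite_dimensionalI)
    show "hyperbola_measure (f q) \<in> AC \<Gamma> (lattice_cross \<alpha> \<beta>)" for q
      unfolding assms(1)
    proof (rule hyperbola_measure_in_AC[OF fi])
      fix x1 x2 assume "(x1, x2) \<in> lattice_cross \<alpha> \<beta>"
      then consider m :: int where "x1 = \<alpha> * of_int m" "x2 = 0" | m :: int where "x1 = 0" "x2 = \<beta> * of_int m"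
        by (auto simp: lattice_cross_def)
      then show "(\<integral>t. f q t *\<^sub>R exp (\<i> * complex_of_real (pi * (x1 * t + x2 / t))) \<partial>lborel) = 0"
      proof cases
        case 1
        have "(\<integral>t. f q t *\<^sub>R exp (\<i> * complex_of_real (pi * (x1 * t + x2 / t))) \<partial>lborel)
          = (\<integral>t. F q (\<alpha> * t) *\<^sub>R exp (\<i> * complex_of_real (pi * (of_int m * (\<alpha> * t)))) \<partial>lborel)"
          by (simp add: f_def 1 mult_ac)
        also have "\<dots> = (1 / \<alpha>) *\<^sub>R fourier_coeff m (F q)"
          unfolding fourier_coeff_def by (rule scale)
        finally show ?thesis using F(2) by simp
      next
        case 2
        have "(\<integral>t. f q t *\<^sub>R exp (\<i> * complex_of_real (pi * (x1 * t + x2 / t))) \<partial>lborel)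
          = (\<integral>t. F q (\<alpha> * t) *\<^sub>R exp (\<i> * complex_of_real (pi * (of_int m * (\<alpha> * \<beta> / (\<alpha> * t))))) \<partial>lborel)"
          using assms(2) by (simp add: f_def 2 mult_ac)
        also have "\<dots> = (1 / \<alpha>) *\<^sub>R fourier_coeff' m (F q)"
          unfolding fourier_coeff'_def by (rule scale)
        finally show ?thesis using F(3) by simp
      qed
    qed
    show "hyperbola_measure (f q) (A q) \<noteq> 0" for q
      using nz[of q] assms(2) by (simp add: hA)
    show "hyperbola_measure (f q') (A q) = 0" if "q \<noteq> q'" for q q'
    proof -
      have "(\<lambda>x. F q' x * indicator {u q<..<v q} x) = (\<lambda>x. 0)"
        using z that by (auto simp: indicator_def fun_eq_iff)
      then show ?thesis by (simp add: hA)
    qed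
  qed
qed

end
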